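(* Let $d,m\ge 2$ be integers, let $H$ be a prime field, and let $\mathbb{F}$ be an extension of $H$ of degree $[\mathbb{F}:H]=m$ with $|\mathbb{F}|\ge 2md$. Let $\delta=1-d/|\mathbb{F}|$ and let $\tau\le\delta/2$ and $\rho\le\delta/8$. Consider the $m$-step $H$-plane-line random walk (described in the context) run on input $f\colon\mathbb{F}^m\to\mathbb{F}$ and $x\in\mathbb{F}^m$. Then: (1) (perfect completeness) if $f\in\mathrm{RM}_{\mathbb{F}}(m,d)$, then for every $x$ and every outcome of the walk, each restriction $f|_{P_i}$, $0\le i\le m$, lies in $\mathrm{RM}_{\mathbb{F}}(2,d)$; (2) (robust soundness) if $\mathrm{dist}(f,Q^* )\le\tau$ for some $Q^*\in\mathrm{RM}_{\mathbb{F}}(m,d)$ but $f(x)\ne Q^*(x)$, then \[ \Pr\Big[\mathrm{dist}_{\{(0,0)\}}\big(f|_{P_0},\mathrm{RM}_{\mathbb{F}}(2,d)\big)\ge\rho\ \ \vee\ \ \exists i\in[m]:\ \mathrm{dist}_{L}\big(f|_{P_i},\mathrm{RM}_{\mathbb{F}}(2,d)\big)\ge\rho\Big]\ \ge\ \Big(1-\frac{4}{|\mathbb{F}|}\Big)^m-\frac{\tau+\frac{2}{|H|}}{\delta-2\rho}, \] where $L=\{(t,0):t\in\mathbb{F}\}\subseteq\mathbb{F}^2$.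
   Context: $\mathrm{RM}_{\mathbb{F}}(m,d)$ is the set of evaluation tables $\mathbb{F}^m\to\mathbb{F}$ of polynomials in $m$ variables of total degree at most $d$ over $\mathbb{F}$. $\mathrm{dist}$ is relative Hamming distance. Weighted distance: for $N$-length strings $u,v$ indexed by a set $I$ with $|I|=N$ and $\emptyset\ne A\subseteq I$, $\mathrm{dist}_A(u,v)=\frac{|\{i\in A:u_i\ne v_i\}|}{2|A|}+\frac{|\{i\in I:u_i\ne v_i\}|}{2N}$, and $\mathrm{dist}_A(u,S)=\min_{v\in S}\mathrm{dist}_A(u,v)$. For $a\in\mathbb{F}^m$ and $h,h'\in\mathbb{F}^m$, the plane $P=(a,h,h')$ is $\{a+th+sh':t,s\in\mathbb{F}\}$ and $f|_P\colon\mathbb{F}^2\to\mathbb{F}$ is $(t,s)\mapsto f(a+th+sh')$ (so $(0,0)$ corresponds to $a$ and $L=\{(t,0)\}$ corresponds to the line $\{a+th:t\in\mathbb{F}\}$). The $m$-step $H$-plane-line random walk from $x$: set $x_0=x$, choose $h_0,h_0'\in H^m$ uniformly, and let $P_0=(x_0,h_0,h_0')$. For $i=1,\dots,m$: choose $s_{i-1},s'_{i-1},t_{i-1},t'_{i-1}\in\mathbb{F}$ uniformly, set $x_i=x_{i-1}+s_{i-1}h_{i-1}+s'_{i-1}h'_{i-1}$, $h_i=t_{i-1}h_{i-1}+t'_{i-1}h'_{i-1}$, the line $\ell_i=\{x_i+th_i:t\in\mathbb{F}\}$, choose $h'_i\in H^m$ uniformly, and set $P_i=(x_i,h_i,h'_i)$.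 All random choices are independent. *)

theory Defs
  imports "HOL-Probability.Probability"
begin

definition vecs :: "nat \<Rightarrow> 'a::zero set \<Rightarrow> (nat \<Rightarrow> 'a) set" where
  "vecs m S = {v. (\<forall>i<m. v i \<in> S) \<and> (\<forall>i\<ge>m. v i = 0)}"

definition prime_subfield :: "'a::field set" where
  "prime_subfield = range (of_nat :: nat \<Rightarrow> 'a)"

definition mono_exps :: "nat \<Rightarrow> nat \<Rightarrow> (nat \<Rightarrow> nat) set" where
  "mono_exps m d = {e. (\<forall>i\<ge>m. e i = 0) \<and> (\<Sum>i<m. e i) \<le> d}"

definition RM :: "nat \<Rightarrow> nat \<Rightarrow> ((nat \<Rightarrow> 'a::field) \<Rightarrow> 'a) set" where
  "RM m d = {f. \<exists>c :: (nat \<Rightarrow> nat) \<Rightarrow> 'a. \<forall>x\<in>vecs m UNIV.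
      f x = (\<Sum>e\<in>mono_exps m d. c e * (\<Prod>i<m. x i ^ e i))}"

definition RM2 :: "nat \<Rightarrow> ('a::field \<times> 'a \<Rightarrow> 'a) set" where
  "RM2 d = {g. \<exists>c :: nat \<Rightarrow> nat \<Rightarrow> 'a. \<forall>t s.
      g (t, s) = (\<Sum>(i, j)\<in>{(i, j). i + j \<le> d}. c i j * t ^ i * s ^ j)}"

definition reldist :: "nat \<Rightarrow> ((nat \<Rightarrow> 'a::field) \<Rightarrow> 'a) \<Rightarrow> ((nat \<Rightarrow> 'a) \<Rightarrow> 'a) \<Rightarrow> real" where
  "reldist m f g = real (card {x\<in>vecs m UNIV. f x \<noteq> g x}) / real (card (vecs m (UNIV::'a set)))"

definition wdist :: "('a::finite \<times> 'a) set \<Rightarrow> ('a \<times> 'a \<Rightarrow> 'b) \<Rightarrow> ('a \<times> 'a \<Rightarrow> 'b) \<Rightarrow> real" where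
  "wdist A u v = real (card {p\<in>A. u p \<noteq> v p}) / (2 * real (card A))
               + real (card {p. u p \<noteq> v p}) / (2 * real (card (UNIV :: ('a \<times> 'a) set)))"

definition wdist_set :: "('a::finite \<times> 'a) set \<Rightarrow> ('a \<times> 'a \<Rightarrow> 'b) \<Rightarrow> ('a \<times> 'a \<Rightarrow> 'b) set \<Rightarrow> real" where
  "wdist_set A u S = Min ((\<lambda>v. wdist A u v) ` S)"

definition restr :: "((nat \<Rightarrow> 'a::field) \<Rightarrow> 'a) \<Rightarrow> (nat \<Rightarrow> 'a) \<times> (nat \<Rightarrow> 'a) \<times> (nat \<Rightarrow> 'a)
    \<Rightarrow> ('a \<times> 'a \<Rightarrow> 'a)" where
  "restr f P = (case P of (a, h, h') \<Rightarrow> (\<lambda>(t, s). f (\<lambda>k. a k + t * h k + s * h' k)))"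

text \<open>Outcomes of the random choices of the m-step H-plane-line walk:
  (h_0, h_0', c) where c (i-1) = (s_{i-1}, s'_{i-1}, t_{i-1}, t'_{i-1}, h'_i) for i = 1..m.\<close>
type_synonym 'a walk_choice =
  "(nat \<Rightarrow> 'a) \<times> (nat \<Rightarrow> 'a) \<times> (nat \<Rightarrow> 'a \<times> 'a \<times> 'a \<times> 'a \<times> (nat \<Rightarrow> 'a))"

definition walk_space :: "nat \<Rightarrow> 'a::field set \<Rightarrow> 'a walk_choice set" where
  "walk_space m H = vecs m H \<times> vecs m H \<times>
     (PiE {..<m} (\<lambda>_. UNIV \<times> UNIV \<times> UNIV \<times> UNIV \<times> vecs m H))"

fun walk_plane :: "(nat \<Rightarrow> 'a::field) \<Rightarrow> 'a walk_choice \<Rightarrow> nat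
    \<Rightarrow> (nat \<Rightarrow> 'a) \<times> (nat \<Rightarrow> 'a) \<times> (nat \<Rightarrow> 'a)" where
  "walk_plane x (h0, h0', c) 0 = (x, h0, h0')"
| "walk_plane x (h0, h0', c) (Suc i) =
     (case walk_plane x (h0, h0', c) i of (xi, hi, hi') \<Rightarrow>
        (case c i of (s, s', t, t', hn) \<Rightarrow>
          ((\<lambda>k. xi k + s * hi k + s' * hi' k), (\<lambda>k. t * hi k + t' * hi' k), hn)))"

end

theory Submission
  imports Defs
begin

text \<open>If every test passes, each plane \<open>P\<^sub>i\<close> carries a low-degree polynomial \<open>Q\<^sub>i\<close> close to
  \<open>f\<close>. Since \<open>f(x) \<noteq> Q\<^sup>*(x)\<close> and the origin carries half of the weight in the first test,
  \<open>Q\<^sub>0 \<noteq> Q\<^sup>*\<close> on \<open>P\<^sub>0\<close>. The points of a random line in a plane are pairwise independent, so by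
  Chebyshev's inequality, with probability at least \<open>1 - 4/q\<close>, \<open>Q\<^sub>i\<close> still differs from \<open>Q\<^sup>*\<close>
  and is still close to \<open>f\<close> on the line \<open>\<ell>\<^sub>i\<^sub>+\<^sub>1\<close>; the test on \<open>P\<^sub>i\<^sub>+\<^sub>1\<close>, which gives weight one
  half to this line, then forces \<open>Q\<^sub>i\<^sub>+\<^sub>1\<close> to agree with \<open>Q\<^sub>i\<close> there. Hence \<open>Q\<^sub>m \<noteq> Q\<^sup>*\<close> on
  \<open>P\<^sub>m\<close>, and by Schwartz--Zippel \<open>f\<close> and \<open>Q\<^sup>*\<close> differ on a fraction at least \<open>\<delta> - 2\<rho>\<close> of
  \<open>P\<^sub>m\<close>. But the directions \<open>h'\<^sub>0, \<dots>, h'\<^sub>m\<^sub>-\<^sub>1\<close> are linearly independent except with probability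
  \<open>2/|H|\<close>, and then a random point of \<open>P\<^sub>m\<close> is uniform, so Markov's inequality makes this unlikely.\<close>

subsection \<open>Low-degree polynomials on planes and lines\<close>

lemma RM2_zero: "(\<lambda>p. 0) \<in> RM2 d"
  unfolding RM2_def by (auto intro!: exI[of _ "\<lambda>_ _. 0"])

lemma finite_pairs_le: "finite {(i, j). i + j \<le> (d::nat)}"
  by (rule finite_subset[of _ "{..d} \<times> {..d}"]) auto

lemma RM2_add: "f \<in> RM2 d \<Longrightarrow> g \<in> RM2 d \<Longrightarrow> (\<lambda>p. f p + g p) \<in> RM2 d"
proof -
  assume "f \<in> RM2 d" "g \<in> RM2 d"
  then obtain c c' where
    "\<forall>t s. f (t, s) = (\<Sum>(i, j)\<in>{(i, j). i + j \<le> d}. c i j * t ^ i * s ^ j)"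
    "\<forall>t s. g (t, s) = (\<Sum>(i, j)\<in>{(i, j). i + j \<le> d}. c' i j * t ^ i * s ^ j)"
    unfolding RM2_def by auto
  then show ?thesis unfolding RM2_def
    by (auto intro!: exI[of _ "\<lambda>i j. c i j + c' i j"]
        simp: sum.distrib[symmetric] algebra_simps split_def)
qed

lemma RM2_scale: "f \<in> RM2 d \<Longrightarrow> (\<lambda>p. a * f p) \<in> RM2 d"
proof -
  assume "f \<in> RM2 d"
  then obtain c where
    "\<forall>t s. f (t, s) = (\<Sum>(i, j)\<in>{(i, j). i + j \<le> d}. c i j * t ^ i * s ^ j)"
    unfolding RM2_def by auto
  then show ?thesis unfolding RM2_def
    by (auto intro!: exI[of _ "\<lambda>i j. a * c i j"]
        simp: sum_distrib_left algebra_simps split_def)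
qed

lemma RM2_diff:
  assumes "f \<in> RM2 d" "g \<in> RM2 d"
  shows "(\<lambda>p. f p - g p) \<in> RM2 d"
  using RM2_add[OF assms(1) RM2_scale[OF assms(2), of "-1"]] by simp

lemma RM2_sum: "(\<And>x. x \<in> A \<Longrightarrow> f x \<in> RM2 d) \<Longrightarrow> (\<lambda>p. \<Sum>x\<in>A. f x p) \<in> RM2 d"
  by (induction A rule: infinite_finite_induct) (auto intro: RM2_zero RM2_add)

lemma RM2_monomial:
  assumes "i + j \<le> d"
  shows "(\<lambda>(t, s). t ^ i * s ^ j) \<in> RM2 d"
proof -
  have "(\<Sum>(i', j')\<in>{(i', j'). i' + j' \<le> d}. (if i' = i \<and> j' = j then 1 else 0) * t ^ i' * s ^ j')
      = t ^ i * s ^ j" for t s :: 'a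
  proof -
    have "(\<Sum>(i', j')\<in>{(i', j'). i' + j' \<le> d}. (if i' = i \<and> j' = j then 1 else 0) * t ^ i' * s ^ j')
      = (\<Sum>z\<in>{(i', j'). i' + j' \<le> d}. if z = (i, j) then t ^ i * s ^ j else 0)"
      by (rule sum.cong) (auto split: if_splits)
    then show ?thesis using assms by (simp add: finite_pairs_le)
  qed
  then show ?thesis unfolding RM2_def
    by (auto intro!: exI[of _ "\<lambda>i' j'. if i' = i \<and> j' = j then 1 else 0"])
qed

text \<open>Expanding the product turns each monomial into three monomials of degree at most one
  higher. The witness \<open>?g\<close> is written in this expanded form so that the closure lemmas
  apply to it.\<close>

lemma RM2_mult_affine:
  assumes "f \<in> RM2 d"
  shows "(\<lambda>(t, s). (a + t * b + s * b') * f (t, s)) \<in> RM2 (Suc d)"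
proof -
  obtain c where c:
    "\<And>t s. f (t, s) = (\<Sum>(i, j)\<in>{(i, j). i + j \<le> d}. c i j * t ^ i * s ^ j)"
    using assms unfolding RM2_def by auto
  let ?g = "\<lambda>p. \<Sum>z\<in>{(i, j). i + j \<le> d}. c (fst z) (snd z) * (
      a * (case p of (t, s) \<Rightarrow> t ^ fst z * s ^ snd z)
      + (b * (case p of (t, s) \<Rightarrow> t ^ Suc (fst z) * s ^ snd z)
      + b' * (case p of (t, s) \<Rightarrow> t ^ fst z * s ^ Suc (snd z))))"
  have "?g \<in> RM2 (Suc d)"
    by (intro RM2_sum RM2_scale RM2_add RM2_monomial) auto
  also have "?g = (\<lambda>(t, s). (a + t * b + s * b') * f (t, s))"
    by (rule ext) (auto simp: c sum_distrib_left split_def algebra_simps intro!: sum.cong)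
  finally show ?thesis .
qed

lemma RM2_mult_affine_power:
  assumes "f \<in> RM2 d"
  shows "(\<lambda>(t, s). (a + t * b + s * b') ^ e * f (t, s)) \<in> RM2 (e + d)"
proof (induction e)
  case (Suc e)
  from RM2_mult_affine[OF Suc.IH, of a b b'] show ?case
    by (simp add: algebra_simps split_def)
qed (use assms in auto)

text \<open>Induction on the number of factors: the last factor uses up \<open>e m\<close> of the
  degree budget, and the induction hypothesis is applied with the remaining
  \<open>d - e m\<close>.\<close>

lemma RM2_prod_affine:
  fixes e :: "nat \<Rightarrow> nat"
  assumes "(\<Sum>k<m. e k) \<le> d"
  shows "(\<lambda>(t, s). \<Prod>k<m. (a k + t * b k + s * b' k) ^ e k) \<in> RM2 d"
  using assms
proof (induction m arbitrary: d)
  case 0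
  show ?case using RM2_monomial[of 0 0 d] by (simp add: split_def)
next
  case (Suc m)
  have "(\<lambda>(t, s). \<Prod>k<m. (a k + t * b k + s * b' k) ^ e k) \<in> RM2 (d - e m)"
    using Suc by auto
  from RM2_mult_affine_power[OF this, of "a m" "b m" "b' m" "e m"] Suc.prems
  show ?case by (simp add: algebra_simps split_def)
qed

lemma vecs_plane_point:
  assumes "a \<in> vecs m UNIV" "h \<in> vecs m UNIV" "h' \<in> vecs m UNIV"
  shows "(\<lambda>k. a k + t * h k + s * h' k :: 'a::field) \<in> vecs m UNIV"
  using assms by (auto simp: vecs_def)

text \<open>Substituting affine functions of \<open>(t, s)\<close> into a monomial does not raise
  its total degree. This gives completeness, and it also puts the restrictions of the global
  codeword into \<open>RM2 d\<close>.\<close>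

lemma restr_RM:
  assumes "f \<in> RM m d" "a \<in> vecs m UNIV" "h \<in> vecs m UNIV" "h' \<in> vecs m UNIV"
  shows "restr f (a, h, h') \<in> RM2 d"
proof -
  obtain c where c: "\<And>x. x \<in> vecs m UNIV \<Longrightarrow>
      f x = (\<Sum>e\<in>mono_exps m d. c e * (\<Prod>i<m. x i ^ e i))"
    using assms(1) unfolding RM_def by auto
  let ?g = "\<lambda>p. \<Sum>e\<in>mono_exps m d. c e * (case p of (t, s) \<Rightarrow> \<Prod>k<m. (a k + t * h k + s * h' k) ^ e k)"
  have "?g \<in> RM2 d"
    by (intro RM2_sum RM2_scale RM2_prod_affine) (auto simp: mono_exps_def)
  also have "?g = restr f (a, h, h')"
    by (rule ext) (auto simp: restr_def c[OF vecs_plane_point[OF assms(2-4)]])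
  finally show ?thesis .
qed

text \<open>Both coordinates become polynomials of degree at most 1 in \<open>r\<close>. The
  direction \<open>(t, t')\<close> may be zero, since the walk may choose a degenerate line.\<close>

lemma RM2_line_poly:
  assumes "g \<in> RM2 d"
  shows "\<exists>P. degree P \<le> d \<and> (\<forall>r. g (s + r * t, s' + r * t') = poly P r)"
proof -
  obtain c where c:
    "\<And>t s. g (t, s) = (\<Sum>(i, j)\<in>{(i, j). i + j \<le> d}. c i j * t ^ i * s ^ j)"
    using assms unfolding RM2_def by auto
  let ?P = "\<Sum>(i, j)\<in>{(i, j). i + j \<le> d}. smult (c i j) ([:s, t:] ^ i * [:s', t':] ^ j)"
  have "degree ([:s, t:] ^ i * [:s', t':] ^ j) \<le> d" if "i + j \<le> d" for i j
  proof -
    have "degree ([:s, t:] ^ i) \<le> i * 1" "degree ([:s', t':] ^ j) \<le> j * 1"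
      by (rule order_trans[OF degree_power_le], auto)+
    then show ?thesis using that degree_mult_le[of "[:s, t:] ^ i" "[:s', t':] ^ j"] by simp
  qed
  then have "degree ?P \<le> d"
    by (intro degree_sum_le finite_pairs_le) (auto intro: order_trans[OF degree_smult_le])
  moreover have "g (s + r * t, s' + r * t') = poly ?P r" for r
    by (simp add: c poly_sum split_def algebra_simps)
  ultimately show ?thesis by blast
qed

lemma card_zeros_le_degree:
  fixes P :: "'a::{field,finite} poly"
  assumes "poly P r \<noteq> 0"
  shows "card {x. poly P x = 0} \<le> degree P"
  using assms by (intro card_poly_roots_bound) auto

text \<open>The leading coefficient in \<open>s\<close> is itself a polynomial in \<open>t\<close>: either it vanishes at
  \<open>t\<close>, or the polynomial in \<open>s\<close> has few roots.\<close>
lemma RM2_card_zeros: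
  fixes g :: "'a::{field,finite} \<times> 'a \<Rightarrow> 'a"
  assumes "g \<in> RM2 d" and "g p0 \<noteq> 0"
  shows "card {p. g p = 0} \<le> d * card (UNIV :: 'a set)"
proof -
  let ?q = "card (UNIV :: 'a set)"
  obtain c where c:
    "\<And>t s. g (t, s) = (\<Sum>(i, j)\<in>{(i, j). i + j \<le> d}. c i j * t ^ i * s ^ j)"
    using assms unfolding RM2_def by auto
  define A where "A j = (\<Sum>i\<le>d - j. monom (c i j) i)" for j
  \<comment> \<open>Grouping by powers of \<open>s\<close>: the coefficient of \<open>s ^ j\<close>
    is a polynomial in \<open>t\<close> of degree at most \<open>d - j\<close>.\<close>
  have g: "g (t, s) = (\<Sum>j\<le>d. poly (A j) t * s ^ j)" for t s
  proof -
    have "g (t, s) = (\<Sum>j\<le>d. \<Sum>i\<le>d - j. c i j * t ^ i * s ^ j)"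
      unfolding c by (subst sum.Sigma)
        (auto intro!: sum.reindex_bij_witness[of _ "\<lambda>(j, i). (i, j)" "\<lambda>(i, j). (j, i)"])
    then show ?thesis by (simp add: A_def poly_sum poly_monom sum_distrib_right)
  qed
  obtain t0 s0 where p0: "p0 = (t0, s0)" by force
  have "\<exists>j\<le>d. poly (A j) t0 \<noteq> 0"
    using assms(2) unfolding p0 g by (auto intro: ccontr)
  then have ne: "{j. j \<le> d \<and> (\<exists>t. poly (A j) t \<noteq> 0)} \<noteq> {}" by auto
  \<comment> \<open>Leading means nonzero as a function of \<open>t\<close>, not as a formal
    polynomial, since over a finite field a nonzero polynomial may vanish everywhere.\<close>
  define k where "k = Max {j. j \<le> d \<and> (\<exists>t. poly (A j) t \<noteq> 0)}"
  have k: "k \<le> d" "\<exists>t. poly (A k) t \<noteq> 0"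
    using Max_in[OF _ ne] by (auto simp: k_def)
  have kmax: "poly (A j) t = 0" if "j > k" "j \<le> d" for j t
    using Max_ge[of "{j. j \<le> d \<and> (\<exists>t. poly (A j) t \<noteq> 0)}" j] that by (fastforce simp flip: k_def)
  have degA: "degree (A k) \<le> d - k"
    unfolding A_def by (intro degree_sum_le) (auto intro: order_trans[OF degree_monom_le])
  have Z1: "card {t. poly (A k) t = 0} \<le> d - k"
    using k(2) card_zeros_le_degree degA order_trans by blast
  have Z2: "card {s. g (t, s) = 0} \<le> k" if "poly (A k) t \<noteq> 0" for t
  proof -
    define B where "B = (\<Sum>j\<le>k. monom (poly (A j) t) j)"
    have "g (t, s) = poly B s" for s
    proof -
      have "(\<Sum>j\<le>d. poly (A j) t * s ^ j) = (\<Sum>j\<le>k. poly (A j) t * s ^ j)"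
        using kmax k(1) by (intro sum.mono_neutral_right) auto
      then show ?thesis by (simp add: g B_def poly_sum poly_monom)
    qed
    moreover have "degree B \<le> k"
      unfolding B_def by (intro degree_sum_le) (auto intro: order_trans[OF degree_monom_le])
    moreover have "coeff B k = poly (A k) t"
      by (simp add: B_def coeff_sum)
    then have "B \<noteq> 0" using that by auto
    ultimately show ?thesis using card_poly_roots_bound[of B] by simp
  qed
  have "{p. g p = 0} = Sigma UNIV (\<lambda>t. {s. g (t, s) = 0})" by auto
  then have "card {p. g p = 0} = (\<Sum>t\<in>UNIV. card {s. g (t, s) = 0})"
    by (simp only:) (subst card_SigmaI, auto)
  \<comment> \<open>A column over a zero of the leading coefficient is counted in full, any other
    one with at most \<open>k\<close> zeros. The total is at most
    \<open>(d - k) * q + q * k = d * q\<close>, where \<open>q\<close> is the field size.\<close>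
  also have "\<dots> \<le> (\<Sum>t\<in>UNIV. (if poly (A k) t = 0 then ?q else 0) + k)"
    using Z2 by (intro sum_mono) (auto intro!: trans_le_add1 card_mono)
  also have "\<dots> = card {t. poly (A k) t = 0} * ?q + ?q * k"
    by (simp add: sum.distrib sum.If_cases)
  also have "\<dots> \<le> (d - k) * ?q + ?q * k"
    using Z1 by simp
  also have "\<dots> = d * ?q"
    using k(1) by (simp add: algebra_simps flip: distrib_left)
  finally show ?thesis .
qed

text \<open>The Schwartz-Zippel bound for the difference of the two tables, read as the minimum
  distance of the code on a plane.\<close>

lemma RM2_card_neq:
  fixes g g' :: "'a::{field,finite} \<times> 'a \<Rightarrow> 'a"
  assumes "g \<in> RM2 d" "g' \<in> RM2 d" "g \<noteq> g'"
  shows "(1 - real d / real (card (UNIV :: 'a set))) * real (card (UNIV :: 'a set)) ^ 2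
    \<le> real (card {p. g p \<noteq> g' p})"
proof -
  let ?q = "card (UNIV :: 'a set)"
  obtain p0 where "g p0 - g' p0 \<noteq> 0" using assms(3) by (metis eq_iff_diff_eq_0 ext)
  from RM2_card_zeros[OF RM2_diff[OF assms(1,2)] this]
  have *: "card {p. g p = g' p} \<le> d * ?q" by simp
  have "card {p. g p \<noteq> g' p} + card {p. g p = g' p} = card (UNIV :: ('a \<times> 'a) set)"
    by (subst card_Un_disjoint[symmetric]) (auto simp: UNIV_def simp del: Collect_const intro!: arg_cong[of _ _ card])
  then have "card {p. g p \<noteq> g' p} + card {p. g p = g' p} = ?q * ?q"
    by (simp add: card_cartesian_product flip: UNIV_Times_UNIV)
  then have "?q * ?q \<le> card {p. g p \<noteq> g' p} + d * ?q"
    using * by linarith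
  then have "real ?q * real ?q \<le> real (card {p. g p \<noteq> g' p}) + real d * real ?q"
    by (metis of_nat_add of_nat_le_iff of_nat_mult)
  moreover have "?q > 0" by (simp add: card_gt_0_iff)
  then have "(1 - real d / real ?q) * real ?q ^ 2 = real ?q * real ?q - real d * real ?q"
    by (simp add: field_simps power2_eq_square)
  ultimately show ?thesis by linarith
qed

subsection \<open>Sampling and counting\<close>

text \<open>The quadruple has the shape of the four scalars drawn in one step of the walk: base
  point \<open>(s, s')\<close> and direction \<open>(t, t')\<close> in plane coordinates, the zero
  direction included.\<close>

fun line_pt :: "'a::field \<times> 'a \<times> 'a \<times> 'a \<Rightarrow> 'a \<Rightarrow> 'a \<times> 'a" where
  "line_pt (s, s', t, t') r = (s + r * t, s' + r * t')"

text \<open>Linear interpolation: the values at two distinct parameters determine base point and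
  direction, and every pair of values occurs.\<close>

lemma bij_line_pt_pair:
  fixes r1 r2 :: "'a::field"
  assumes "r1 \<noteq> r2"
  shows "bij (\<lambda>w. (line_pt w r1, line_pt w r2))"
proof (rule o_bij)
  let ?g = "\<lambda>((a, a'), (b, b')). let t = (b - a) / (r2 - r1); t' = (b' - a') / (r2 - r1)
      in (a - r1 * t, a' - r1 * t', t, t')"
  have r: "r2 - r1 \<noteq> 0" using assms by simp
  have l1: "(r2 * y - r1 * y) / (r2 - r1) = y" for y
    using r by (simp flip: left_diff_distrib)
  have l2: "x - r1 * ((y - x) / (r2 - r1)) + r2 * ((y - x) / (r2 - r1)) = y" for x y
  proof -
    have "x - r1 * z + r2 * z = x + (r2 - r1) * z" for z by (simp add: algebra_simps)
    then have "x - r1 * ((y - x) / (r2 - r1)) + r2 * ((y - x) / (r2 - r1))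
        = x + (r2 - r1) * ((y - x) / (r2 - r1))" .
    also have "\<dots> = y" using r by simp
    finally show ?thesis .
  qed
  show "?g \<circ> (\<lambda>w. (line_pt w r1, line_pt w r2)) = id"
    by (auto simp: fun_eq_iff Let_def l1 simp del: times_divide_eq_right)
  show "(\<lambda>w. (line_pt w r1, line_pt w r2)) \<circ> ?g = id"
    by (auto simp: fun_eq_iff Let_def l2 simp del: times_divide_eq_right)
qed

lemma sum_line_pt_pair:
  fixes \<phi> \<psi> :: "'a::{field,finite} \<times> 'a \<Rightarrow> real"
  assumes "r1 \<noteq> r2"
  shows "(\<Sum>w\<in>UNIV. \<phi> (line_pt w r1) * \<psi> (line_pt w r2)) = sum \<phi> UNIV * sum \<psi> UNIV"
proof -
  have "(\<Sum>w\<in>UNIV. \<phi> (line_pt w r1) * \<psi> (line_pt w r2))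
      = (\<Sum>z\<in>UNIV. \<phi> (fst z) * \<psi> (snd z))"
    using sum.reindex_bij_betw[OF bij_line_pt_pair[OF assms], of "\<lambda>z. \<phi> (fst z) * \<psi> (snd z)"]
    by simp
  also have "\<dots> = sum \<phi> UNIV * sum \<psi> UNIV"
    unfolding sum_product sum.cartesian_product UNIV_Times_UNIV by (simp add: split_def)
  finally show ?thesis .
qed

text \<open>Chebyshev's inequality: the points of a random (possibly degenerate) line are pairwise
  independent and uniform.\<close>
lemma line_sampling:
  fixes D :: "('a::{field,finite} \<times> 'a) set" and \<epsilon> :: real
  defines "q \<equiv> real (card (UNIV :: 'a set))"
  defines "\<mu> \<equiv> real (card D) / q ^ 2"
  assumes "\<epsilon> \<ge> 0"
  shows "\<epsilon>\<^sup>2 * real (card {w. \<epsilon> * q \<le> \<bar>real (card {r. line_pt w r \<in> D}) - \<mu> * q\<bar>}) \<le> q ^ 3 / 4"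
proof -
  let ?B = "{w. \<epsilon> * q \<le> \<bar>real (card {r. line_pt w r \<in> D}) - \<mu> * q\<bar>}"
  define \<phi> where "\<phi> p = indicator D p - \<mu>" for p
  have q: "q > 0" by (simp add: q_def card_gt_0_iff)
  have cardUU: "real (card (UNIV :: ('a \<times> 'a) set)) = q ^ 2"
    by (simp add: q_def card_cartesian_product power2_eq_square flip: UNIV_Times_UNIV)
  have D: "real (card D) = \<mu> * q ^ 2" using q by (simp add: \<mu>_def)
  have ind: "(\<Sum>p\<in>UNIV. indicator D p) = real (card D)"
    by (simp add: indicator_def sum.If_cases)
  have "sum \<phi> UNIV = real (card D) - (\<Sum>(p :: 'a \<times> 'a)\<in>UNIV. \<mu>)"
    unfolding \<phi>_def sum_subtractf ind ..
  then have \<phi>0: "sum \<phi> UNIV = 0"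
    by (simp only: sum_constant cardUU D) simp
  have "sum (\<lambda>p. \<phi> p ^ 2) UNIV = (\<Sum>p\<in>UNIV. (1 - 2 * \<mu>) * indicator D p + \<mu>\<^sup>2)"
    by (intro sum.cong) (auto simp: \<phi>_def power2_eq_square indicator_def algebra_simps)
  also have "\<dots> = (1 - 2 * \<mu>) * real (card D) + q\<^sup>2 * \<mu>\<^sup>2"
    by (simp only: sum.distrib sum_constant cardUU ind sum_distrib_left[symmetric])
  also have "\<dots> = q ^ 2 * (\<mu> * (1 - \<mu>))"
    unfolding D by (simp add: algebra_simps power2_eq_square)
  also have "\<dots> \<le> q ^ 2 * (1 / 4)"
  proof -
    have "0 \<le> (\<mu> - 1 / 2)\<^sup>2" by simp
    then have "\<mu> * (1 - \<mu>) \<le> 1 / 4" by (simp add: power2_eq_square algebra_simps)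
    then show ?thesis by (intro mult_left_mono) auto
  qed
  finally have \<phi>2: "sum (\<lambda>p. \<phi> p ^ 2) UNIV \<le> q ^ 2 / 4" by simp
  have N: "real (card {r. line_pt w r \<in> D}) - \<mu> * q = (\<Sum>r\<in>UNIV. \<phi> (line_pt w r))" for w
  proof -
    have "(\<Sum>r\<in>UNIV. indicator D (line_pt w r)) = real (card {r. line_pt w r \<in> D})"
      by (simp add: indicator_def sum.If_cases)
    then show ?thesis by (simp add: \<phi>_def sum_subtractf q_def mult.commute)
  qed
  have diag: "(\<Sum>w\<in>UNIV. \<phi> (line_pt w r1) * \<phi> (line_pt w r2)) \<le> (if r1 = r2 then q ^ 4 / 4 else 0)"
    for r1 r2
  proof (cases "r1 = r2")
    case True
    \<comment> \<open>A single point is handled as a pair with the constant function 1 at the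
      auxiliary parameter \<open>r1 + 1\<close>, which differs from \<open>r1\<close>.\<close>
    have "(\<Sum>w\<in>UNIV. (\<phi> (line_pt w r1)) ^ 2 * 1) = sum (\<lambda>p. \<phi> p ^ 2) UNIV * (\<Sum>(p::'a\<times>'a)\<in>UNIV. 1)"
      by (rule sum_line_pt_pair[where ?r2.0 = "r1 + 1"]) simp
    also have "\<dots> \<le> (q ^ 2 / 4) * q ^ 2"
      using \<phi>2 by (simp only: sum_constant cardUU mult_1_right) (intro mult_right_mono, auto)
    finally show ?thesis using True by (simp add: power2_eq_square power4_eq_xxxx)
  next
    case False
    then show ?thesis by (simp add: sum_line_pt_pair \<phi>0)
  qed
  have "(\<epsilon> * q)\<^sup>2 * real (card ?B) = (\<Sum>w\<in>?B. (\<epsilon> * q)\<^sup>2)" by simp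
  also have "\<dots> \<le> (\<Sum>w\<in>?B. (\<Sum>r\<in>UNIV. \<phi> (line_pt w r)) ^ 2)"
  proof (rule sum_mono)
    fix w assume "w \<in> ?B"
    then have "\<bar>\<epsilon> * q\<bar> \<le> \<bar>\<Sum>r\<in>UNIV. \<phi> (line_pt w r)\<bar>"
      using assms(3) q by (simp add: N)
    then show "(\<epsilon> * q)\<^sup>2 \<le> (\<Sum>r\<in>UNIV. \<phi> (line_pt w r)) ^ 2"
      by (simp only: abs_le_square_iff)
  qed
  also have "\<dots> \<le> (\<Sum>w\<in>UNIV. (\<Sum>r\<in>UNIV. \<phi> (line_pt w r)) ^ 2)"
    by (rule sum_mono2) auto
  also have "\<dots> = (\<Sum>w\<in>UNIV. \<Sum>r1\<in>UNIV. \<Sum>r2\<in>UNIV. \<phi> (line_pt w r1) * \<phi> (line_pt w r2))"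
    by (simp add: power2_eq_square sum_product)
  also have "\<dots> = (\<Sum>r1\<in>UNIV. \<Sum>r2\<in>UNIV. \<Sum>w\<in>UNIV. \<phi> (line_pt w r1) * \<phi> (line_pt w r2))"
    by (subst sum.swap, subst (2) sum.swap) (rule refl)
  also have "\<dots> \<le> (\<Sum>(r1::'a)\<in>UNIV. \<Sum>r2\<in>UNIV. if r1 = r2 then q ^ 4 / 4 else 0)"
    by (intro sum_mono diag)
  also have "\<dots> = q\<^sup>2 * (q ^ 3 / 4)"
    by (simp add: q_def power2_eq_square power3_eq_cube power4_eq_xxxx)
  finally have "q\<^sup>2 * (\<epsilon>\<^sup>2 * real (card ?B)) \<le> q\<^sup>2 * (q ^ 3 / 4)"
    by (simp add: power_mult_distrib mult_ac)
  then show ?thesis using q by (simp only: mult_le_cancel_left_pos zero_less_power)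
qed

text \<open>A chain rule in counting form: every good prefix has at least a fraction \<beta> of good
  extensions, and distinct prefixes or extensions give distinct functions. The constant
  \<open>undefined\<close> function is the only element of the empty product.\<close>

lemma sequential_count:
  fixes G :: "nat \<Rightarrow> (nat \<Rightarrow> 'b) \<Rightarrow> bool" and \<beta> :: real
  assumes "finite S" "\<beta> \<ge> 0" "G 0 (\<lambda>_. undefined)"
    and step: "\<And>i c. i < m \<Longrightarrow> c \<in> PiE {..<i} (\<lambda>_. S) \<Longrightarrow> G i c \<Longrightarrow>
        \<beta> * real (card S) \<le> real (card {y\<in>S. G (Suc i) (c(i := y))})"
    and "n \<le> m"
  shows "\<beta> ^ n * real (card S) ^ n \<le> real (card {c \<in> PiE {..<n} (\<lambda>_. S). G n c})"
  using \<open>n \<le> m\<close>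
proof (induction n)
  case 0
  have "{c \<in> PiE {..<0} (\<lambda>_. S). G 0 c} = {\<lambda>_. undefined}" using assms(3) by auto
  then show ?case by simp
next
  case (Suc n)
  let ?A = "{c \<in> PiE {..<n} (\<lambda>_. S). G n c}"
  let ?Y = "\<lambda>c. {y\<in>S. G (Suc n) (c(n := y))}"
  have fin: "finite (PiE {..<k} (\<lambda>_. S))" for k :: nat
    using assms(1) by (intro finite_PiE) auto
  have inj: "inj_on (\<lambda>(c, y). c(n := y)) (Sigma ?A ?Y)"
  proof (rule inj_onI, clarify)
    fix c y c' y'
    assume *: "c \<in> PiE {..<n} (\<lambda>_. S)" "c' \<in> PiE {..<n} (\<lambda>_. S)" "c(n := y) = c'(n := y')"
    have "y = y'" using fun_cong[OF *(3), of n] by simp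
    moreover have "c j = c' j" for j
      using fun_cong[OF *(3), of j] *(1,2) by (cases "j = n") (auto simp: PiE_def extensional_def)
    ultimately show "c = c' \<and> y = y'" by auto
  qed
  have "\<beta> ^ Suc n * real (card S) ^ Suc n = (\<beta> ^ n * real (card S) ^ n) * (\<beta> * real (card S))"
    by simp
  also have "\<dots> \<le> real (card ?A) * (\<beta> * real (card S))"
    using Suc assms(2) by (intro mult_right_mono) auto
  also have "\<dots> = (\<Sum>c\<in>?A. \<beta> * real (card S))" by simp
  also have "\<dots> \<le> (\<Sum>c\<in>?A. real (card (?Y c)))"
    using Suc.prems by (intro sum_mono step) auto
  also have "\<dots> = real (card (Sigma ?A ?Y))"
    using fin assms(1) by (subst card_SigmaI) auto
  also have "\<dots> = real (card ((\<lambda>(c, y). c(n := y)) ` Sigma ?A ?Y))"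
    by (simp add: card_image[OF inj])
  also have "\<dots> \<le> real (card {c \<in> PiE {..<Suc n} (\<lambda>_. S). G (Suc n) c})"
  proof (intro of_nat_mono card_mono)
    show "finite {c \<in> PiE {..<Suc n} (\<lambda>_. S). G (Suc n) c}"
      by (rule finite_subset[OF _ fin[of "Suc n"]]) auto
  qed (auto simp: PiE_iff extensional_def less_Suc_eq)
  finally show ?case .
qed

text \<open>Averaging over a family of permutations of \<open>W\<close>: each of them preserves the
  number of elements satisfying \<open>P\<close>, and the double sum is swapped.\<close>

lemma card_mult_shift:
  assumes "finite W" "finite V" "\<And>v. v \<in> V \<Longrightarrow> bij_betw (T v) W W"
  shows "card V * card {w\<in>W. P w} = (\<Sum>w\<in>W. card {v\<in>V. P (T v w)})"
proof -
  have ind: "card {x\<in>A. Q x} = (\<Sum>x\<in>A. if Q x then 1 else 0)" if "finite A" for A :: "'z set" and Q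
    using that by (simp add: sum.If_cases Int_def)
  have "(\<Sum>w\<in>W. card {v\<in>V. P (T v w)}) = (\<Sum>v\<in>V. \<Sum>w\<in>W. if P (T v w) then 1 else 0)"
    by (subst sum.swap) (simp add: ind assms(2))
  also have "\<dots> = (\<Sum>v\<in>V. \<Sum>w\<in>W. if P w then 1 else 0)"
    by (intro sum.cong refl sum.reindex_bij_betw[OF assms(3)])
  also have "\<dots> = card V * card {w\<in>W. P w}"
    by (simp add: ind assms(1))
  finally show ?thesis by simp
qed

text \<open>A bad line carries a polynomial \<open>R\<close> that agrees with \<open>g\<close> on it
  and is close to \<open>u\<close>, although \<open>Q\<close> differs from \<open>g\<close> on the
  plane. Either the line misses the set where \<open>Q\<close> and \<open>g\<close> differ, or it
  meets the set where \<open>u\<close> and \<open>Q\<close> differ far too often. Chebyshev's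
  inequality makes both deviations rare.\<close>

lemma step_count:
  fixes u Q g :: "'a::{field,finite} \<times> 'a \<Rightarrow> 'a" and d :: nat and \<rho> :: real
  defines "q \<equiv> real (card (UNIV :: 'a set))"
  defines "\<delta> \<equiv> 1 - real d / q"
  assumes "Q \<in> RM2 d" "g \<in> RM2 d" "Q \<noteq> g"
    and near: "real (card {p. u p \<noteq> Q p}) < 2 * \<rho> * q\<^sup>2"
    and "\<rho> \<le> \<delta> / 8" "\<delta> \<ge> 3 / 4"
  shows "real (card {w. \<exists>R\<in>RM2 d. real (card {r. u (line_pt w r) \<noteq> R (r, 0)}) < 2 * \<rho> * q
      \<and> (\<forall>r. R (r, 0) = g (line_pt w r))}) \<le> 4 * q ^ 3"
proof -
  let ?bad = "{w. \<exists>R\<in>RM2 d. real (card {r. u (line_pt w r) \<noteq> R (r, 0)}) < 2 * \<rho> * q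
      \<and> (\<forall>r. R (r, 0) = g (line_pt w r))}"
  let ?dev = "\<lambda>\<epsilon> D. {w :: 'a \<times> 'a \<times> 'a \<times> 'a.
      \<epsilon> * q \<le> \<bar>real (card {r. line_pt w r \<in> D}) - real (card D) / q\<^sup>2 * q\<bar>}"
  let ?D1 = "{p. Q p \<noteq> g p}" and ?D2 = "{p. u p \<noteq> Q p}"
  have q: "q > 0" by (simp add: q_def card_gt_0_iff)
  have D1: "\<delta> * q \<le> real (card ?D1) / q\<^sup>2 * q"
    using RM2_card_neq[OF assms(3-5)] q
    by (intro mult_right_mono) (simp_all add: field_simps flip: q_def \<delta>_def)
  have D2: "real (card ?D2) / q\<^sup>2 * q \<le> 2 * \<rho> * q"
    using near q by (intro mult_right_mono) (simp_all add: field_simps)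
  \<comment> \<open>The thresholds are \<delta> \<ge> 3/4 and \<delta> - 4\<rho> \<ge> \<delta>/2
    \<ge> 3/8.\<close>
  have "?bad \<subseteq> ?dev (3 / 4) ?D1 \<union> ?dev (3 / 8) ?D2"
  proof
    fix w assume "w \<in> ?bad"
    then obtain R where R: "R \<in> RM2 d" "real (card {r. u (line_pt w r) \<noteq> R (r, 0)}) < 2 * \<rho> * q"
      "\<forall>r. R (r, 0) = g (line_pt w r)" by blast
    show "w \<in> ?dev (3 / 4) ?D1 \<union> ?dev (3 / 8) ?D2"
    proof (cases "\<forall>r. Q (line_pt w r) = g (line_pt w r)")
      case True
      have "3 / 4 * q \<le> \<delta> * q" using assms(8) q by (intro mult_right_mono) auto
      moreover have "card {r. line_pt w r \<in> ?D1} = 0" using True by simp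
      ultimately have "w \<in> ?dev (3 / 4) ?D1" using D1 by (simp only: mem_Collect_eq)
      then show ?thesis by blast
    next
      case False
      obtain s s' t t' where w: "w = (s, s', t, t')" by (metis prod_cases4)
      obtain P1 where P1: "degree P1 \<le> d" "\<And>r. Q (line_pt w r) = poly P1 r"
        using RM2_line_poly[OF assms(3), of s t s' t'] unfolding w by auto
      obtain P2 where P2: "degree P2 \<le> d" "\<And>r. R (r, 0) = poly P2 r"
        using RM2_line_poly[OF R(1), of 0 1 0 0] by auto
      obtain r0 where "poly (P1 - P2) r0 \<noteq> 0" using False R(3) P1(2) P2(2) by auto
      then have "card {r. poly (P1 - P2) r = 0} \<le> degree (P1 - P2)" by (rule card_zeros_le_degree)
      also have "\<dots> \<le> d" using P1(1) P2(1) by (rule degree_diff_le)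
      finally have agree: "card {r. Q (line_pt w r) = R (r, 0)} \<le> d" by (simp add: P1(2) P2(2))
      \<comment> \<open>At each parameter, \<open>Q\<close> equals \<open>R\<close>, or
        \<open>u\<close> differs from \<open>R\<close>, or \<open>u\<close> differs from
        \<open>Q\<close>. The first happens at most \<open>d\<close> times and the second fewer than
        \<open>2 * \<rho> * q\<close> times, so the third is frequent.\<close>
      have "UNIV \<subseteq> {r. Q (line_pt w r) = R (r, 0)}
          \<union> ({r. u (line_pt w r) \<noteq> R (r, 0)} \<union> {r. line_pt w r \<in> ?D2})" by auto
      then have "card (UNIV :: 'a set) \<le> card ({r. Q (line_pt w r) = R (r, 0)}
          \<union> ({r. u (line_pt w r) \<noteq> R (r, 0)} \<union> {r. line_pt w r \<in> ?D2}))"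
        by (intro card_mono) auto
      also have "\<dots> \<le> card {r. Q (line_pt w r) = R (r, 0)}
          + (card {r. u (line_pt w r) \<noteq> R (r, 0)} + card {r. line_pt w r \<in> ?D2})"
        by (intro order_trans[OF card_Un_le] add_left_mono card_Un_le)
      finally have "q \<le> real d + (real (card {r. u (line_pt w r) \<noteq> R (r, 0)})
          + real (card {r. line_pt w r \<in> ?D2}))"
        using agree unfolding q_def by linarith
      moreover have "q - real d = \<delta> * q" using q by (simp add: \<delta>_def field_simps)
      ultimately have "\<delta> * q - 4 * \<rho> * q
          \<le> real (card {r. line_pt w r \<in> ?D2}) - real (card ?D2) / q\<^sup>2 * q"
        using R(2) D2 by linarith
      moreover have "3 / 8 * q \<le> (\<delta> - 4 * \<rho>) * q"
        using assms(7,8) q by (intro mult_right_mono) auto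
      moreover have "(\<delta> - 4 * \<rho>) * q = \<delta> * q - 4 * \<rho> * q" by (rule left_diff_distrib)
      ultimately have "3 / 8 * q \<le> \<bar>real (card {r. line_pt w r \<in> ?D2}) - real (card ?D2) / q\<^sup>2 * q\<bar>"
        by linarith
      then have "w \<in> ?dev (3 / 8) ?D2" by (rule CollectI)
      then show ?thesis by blast
    qed
  qed
  then have "card ?bad \<le> card (?dev (3 / 4) ?D1 \<union> ?dev (3 / 8) ?D2)"
    by (intro card_mono) auto
  also have "\<dots> \<le> card (?dev (3 / 4) ?D1) + card (?dev (3 / 8) ?D2)" by (rule card_Un_le)
  finally have "real (card ?bad) \<le> real (card (?dev (3 / 4) ?D1)) + real (card (?dev (3 / 8) ?D2))"
    by linarith
  \<comment> \<open>The two bounds are \<open>4/9 * q ^ 3\<close> and \<open>16/9 * q ^ 3\<close>;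
    their sum \<open>20/9 * q ^ 3\<close> is below \<open>4 * q ^ 3\<close>.\<close>
  moreover have "(3 / 4)\<^sup>2 * real (card (?dev (3 / 4) ?D1)) \<le> q ^ 3 / 4"
    unfolding q_def by (rule line_sampling) simp
  moreover have "(3 / 8)\<^sup>2 * real (card (?dev (3 / 8) ?D2)) \<le> q ^ 3 / 4"
    unfolding q_def by (rule line_sampling) simp
  moreover have "q ^ 3 \<ge> 0" using q by simp
  ultimately show ?thesis by (simp add: power2_eq_square)
qed

section \<open>Vectors and weighted distance\<close>

lemma finite_card_vecs:
  assumes "finite S"
  shows "finite (vecs m S)" "card (vecs m S) = card S ^ m"
proof -
  have bij: "bij_betw (\<lambda>v i. if i < m then v i else 0) (PiE {..<m} (\<lambda>_. S)) (vecs m S)"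
    by (rule bij_betwI[where g = "\<lambda>v. restrict v {..<m}"])
       (auto simp: vecs_def PiE_iff extensional_def fun_eq_iff)
  show "finite (vecs m S)"
    using bij_betw_finite[OF bij] assms by (auto intro: finite_PiE)
  show "card (vecs m S) = card S ^ m"
    using bij_betw_same_card[OF bij] by (simp add: card_PiE)
qed

lemma wdist_set_lessD:
  fixes u :: "'a::finite \<times> 'a \<Rightarrow> 'b::finite"
  assumes "wdist_set A u S < \<rho>" "S \<noteq> {}"
  shows "\<exists>v\<in>S. wdist A u v < \<rho>"
  using assms unfolding wdist_set_def by (subst (asm) Min_less_iff) auto

text \<open>The term for \<open>A\<close> is nonnegative, and the other term is half the plain
  relative distance, hence the factor 2.\<close>

lemma wdist_less_card:
  fixes u :: "'a::finite \<times> 'a \<Rightarrow> 'b"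
  assumes "wdist A u v < \<rho>"
  shows "real (card {p. u p \<noteq> v p}) < 2 * \<rho> * real (card (UNIV :: 'a set)) ^ 2"
proof -
  have q: "card (UNIV :: 'a set) > 0" by (simp add: card_gt_0_iff)
  have "real (card {p. u p \<noteq> v p}) / (2 * real (card (UNIV :: ('a \<times> 'a) set))) < \<rho>"
    using assms unfolding wdist_def by (smt (verit) divide_nonneg_nonneg of_nat_0_le_iff)
  moreover have "real (card (UNIV :: ('a \<times> 'a) set)) = real (card (UNIV :: 'a set)) ^ 2"
    by (simp add: card_cartesian_product power2_eq_square flip: UNIV_Times_UNIV)
  ultimately show ?thesis using q by (simp add: field_simps power2_eq_square)
qed

text \<open>A disagreement at the only point of the distinguished set already costs 1/2.\<close>

lemma wdist_origin_less:
  assumes "wdist {(0, 0)} u v < \<rho>" "\<rho> \<le> 1 / 2"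
  shows "u (0, 0) = v (0, 0)"
proof (rule ccontr)
  assume "u (0, 0) \<noteq> v (0, 0)"
  then have "{p\<in>{(0, 0)}. u p \<noteq> v p} = {(0, 0)}" by auto
  then have "wdist {(0, 0)} u v \<ge> 1 / 2" by (simp add: wdist_def)
  then show False using assms by simp
qed

lemma wdist_axis_less:
  fixes u :: "'a::{field,finite} \<times> 'a \<Rightarrow> 'b"
  assumes "wdist {(t, 0) | t. True} u v < \<rho>"
  shows "real (card {r. u (r, 0) \<noteq> v (r, 0)}) < 2 * \<rho> * real (card (UNIV :: 'a set))"
proof -
  let ?L = "{(t :: 'a, 0 :: 'a) | t. True}"
  have q: "card (UNIV :: 'a set) > 0" by (simp add: card_gt_0_iff)
  have inj: "inj_on (\<lambda>t. (t :: 'a, 0 :: 'a)) A" for A by (auto intro: inj_onI)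
  have "?L = (\<lambda>t. (t, 0)) ` UNIV" by auto
  then have cL: "card ?L = card (UNIV :: 'a set)" by (simp add: card_image[OF inj])
  have "{p\<in>?L. u p \<noteq> v p} = (\<lambda>t. (t, 0)) ` {r. u (r, 0) \<noteq> v (r, 0)}" by auto
  then have cN: "card {p\<in>?L. u p \<noteq> v p} = card {r. u (r, 0) \<noteq> v (r, 0)}"
    by (simp add: card_image[OF inj])
  have "real (card {p\<in>?L. u p \<noteq> v p}) / (2 * real (card ?L)) < \<rho>"
    using assms unfolding wdist_def by (smt (verit) divide_nonneg_nonneg of_nat_0_le_iff)
  then show ?thesis using q unfolding cN cL by (simp add: field_simps)
qed

section \<open>Planes visited by the walk\<close>

lemma walk_plane_cong:
  assumes "\<And>j. j < i \<Longrightarrow> c j = c' j"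
  shows "walk_plane x (h0, h0', c) i = walk_plane x (h0, h0', c') i"
  using assms by (induction i) auto

lemma walk_plane_vecs:
  assumes "x \<in> vecs m UNIV" "h0 \<in> vecs m UNIV" "h0' \<in> vecs m UNIV"
    and "\<And>j. j < i \<Longrightarrow> c j \<in> UNIV \<times> UNIV \<times> UNIV \<times> UNIV \<times> vecs m UNIV"
  shows "walk_plane x (h0, h0', c) i \<in> vecs m UNIV \<times> vecs m UNIV \<times> vecs m UNIV"
  using assms(4)
proof (induction i)
  case (Suc i)
  obtain a h h' where P: "walk_plane x (h0, h0', c) i = (a, h, h')" by (metis prod_cases3)
  obtain s s' t t' hn where ci: "c i = (s, s', t, t', hn)" by (metis prod_cases5)
  from Suc P have "a \<in> vecs m UNIV" "h \<in> vecs m UNIV" "h' \<in> vecs m UNIV" by auto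
  moreover have "hn \<in> vecs m UNIV" using Suc.prems[of i] ci by auto
  ultimately show ?case by (simp add: P ci) (auto simp: vecs_def)
qed (use assms(1-3) in auto)

lemma vecs_mono: "S \<subseteq> T \<Longrightarrow> vecs m S \<subseteq> vecs m T"
  by (auto simp: vecs_def)

lemma restr_walk_plane_RM2:
  assumes "f \<in> RM m d" "x \<in> vecs m UNIV" "h0 \<in> vecs m UNIV" "h0' \<in> vecs m UNIV"
    and "\<And>j. j < i \<Longrightarrow> c j \<in> UNIV \<times> UNIV \<times> UNIV \<times> UNIV \<times> vecs m UNIV"
  shows "restr f (walk_plane x (h0, h0', c) i) \<in> RM2 d"
proof -
  have "walk_plane x (h0, h0', c) i \<in> vecs m UNIV \<times> vecs m UNIV \<times> vecs m UNIV"
    by (rule walk_plane_vecs) (use assms in auto)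
  then show ?thesis using restr_RM[OF assms(1)]
    by (cases "walk_plane x (h0, h0', c) i") auto
qed

text \<open>The link between consecutive planes: the first axis of the new plane is the random line
  chosen in the old one, and the fresh direction \<open>hn\<close> does not affect it.\<close>

lemma restr_walk_plane_Suc_axis:
  assumes "c i = (s, s', t, t', hn)"
  shows "restr f (walk_plane x (h0, h0', c) (Suc i)) (r, 0)
    = restr f (walk_plane x (h0, h0', c) i) (line_pt (s, s', t, t') r)"
  using assms by (cases "walk_plane x (h0, h0', c) i") (simp add: restr_def algebra_simps)

subsection \<open>Mixing of the walk\<close>

lemma prime_subfield_closed:
  fixes a b :: "'a::{field,finite}"
  shows "(0::'a) \<in> prime_subfield" "(1::'a) \<in> prime_subfield"
    and "a \<in> prime_subfield \<Longrightarrow> b \<in> prime_subfield \<Longrightarrow> a + b \<in> prime_subfield"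
    and "a \<in> prime_subfield \<Longrightarrow> b \<in> prime_subfield \<Longrightarrow> a * b \<in> prime_subfield"
proof -
  show "(0::'a) \<in> prime_subfield" "(1::'a) \<in> prime_subfield"
    unfolding prime_subfield_def using of_nat_0 of_nat_1 by (metis rangeI)+
  assume "a \<in> prime_subfield" "b \<in> prime_subfield"
  then obtain i j where ij: "a = of_nat i" "b = of_nat j" by (auto simp: prime_subfield_def)
  have "of_nat (i + j) \<in> range (of_nat :: nat \<Rightarrow> 'a)" "of_nat (i * j) \<in> range (of_nat :: nat \<Rightarrow> 'a)"
    by blast+
  then show "a + b \<in> prime_subfield" "a * b \<in> prime_subfield"
    unfolding ij prime_subfield_def by simp_all
qed

text \<open>Negatives come from finiteness: adding \<open>a\<close> is an injective self-map of a
  finite set, so it attains 0. Inverses below arise in the same way from multiplication.\<close>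

lemma prime_subfield_uminus:
  fixes a :: "'a::{field,finite}"
  assumes "a \<in> prime_subfield"
  shows "- a \<in> prime_subfield"
proof -
  have "(\<lambda>b. a + b) ` prime_subfield = prime_subfield"
    by (rule endo_inj_surj) (auto intro: inj_onI prime_subfield_closed(3) assms)
  then obtain b where "b \<in> prime_subfield" "a + b = 0"
    using prime_subfield_closed(1) by (metis (no_types, lifting) imageE)
  then show ?thesis by (metis add_eq_0_iff)
qed

lemma prime_subfield_inverse:
  fixes a :: "'a::{field,finite}"
  assumes "a \<in> prime_subfield"
  shows "inverse a \<in> prime_subfield"
proof (cases "a = 0")
  case False
  have "(\<lambda>b. a * b) ` prime_subfield = prime_subfield"
    using False by (intro endo_inj_surj) (auto intro: inj_onI prime_subfield_closed(4) assms)
  then obtain b where "b \<in> prime_subfield" "a * b = 1"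
    using prime_subfield_closed(2) by (metis (no_types, lifting) imageE)
  then show ?thesis by (metis inverse_unique)
qed (simp add: prime_subfield_closed)

lemma prime_subfield_sum:
  fixes g :: "'b \<Rightarrow> 'a::{field,finite}"
  shows "(\<And>x. x \<in> A \<Longrightarrow> g x \<in> prime_subfield) \<Longrightarrow> sum g A \<in> prime_subfield"
  by (induction A rule: infinite_finite_induct) (auto intro: prime_subfield_closed)

lemma card_prime_subfield_ge_2: "card (prime_subfield :: 'a::{field,finite} set) \<ge> 2"
proof -
  have "card {0, 1 :: 'a} \<le> card (prime_subfield :: 'a set)"
    by (intro card_mono) (auto intro: prime_subfield_closed)
  then show ?thesis by simp
qed

text \<open>Normal forms, up to scaling, of nonzero coefficient vectors over the prime subfield:
  \<open>k\<close> is the last nonzero position.\<close>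

definition monic_vecs :: "nat \<Rightarrow> nat \<Rightarrow> (nat \<Rightarrow> 'a::field) set" where
  "monic_vecs m k = {a \<in> vecs m prime_subfield. a k = 1 \<and> (\<forall>j>k. a j = 0)}"

text \<open>Only the coordinates below \<open>k\<close> are free, so erasing the leading 1 embeds
  these vectors into \<open>vecs k\<close>.\<close>

lemma card_monic_vecs:
  "card (monic_vecs m k :: (nat \<Rightarrow> 'a::{field,finite}) set) \<le> card (prime_subfield :: 'a set) ^ k"
proof -
  let ?H = "prime_subfield :: 'a set"
  have "inj_on (\<lambda>a. a(k := 0)) (monic_vecs m k :: (nat \<Rightarrow> 'a) set)"
  proof (rule inj_onI, rule ext)
    fix a b :: "nat \<Rightarrow> 'a" and j
    assume ab: "a \<in> monic_vecs m k" "b \<in> monic_vecs m k" and eq: "a(k := 0) = b(k := 0)"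
    show "a j = b j"
      using ab fun_cong[OF eq, of j] by (cases "j = k") (auto simp: monic_vecs_def)
  qed
  moreover have "(\<lambda>a. a(k := 0)) ` monic_vecs m k \<subseteq> vecs k ?H"
  proof clarify
    fix a :: "nat \<Rightarrow> 'a" assume "a \<in> monic_vecs m k"
    then have a: "\<forall>i<m. a i \<in> ?H" "\<forall>i\<ge>m. a i = 0" "\<forall>j>k. a j = 0"
      by (auto simp: monic_vecs_def vecs_def)
    then have "a i \<in> ?H" for i using prime_subfield_closed(1) by (cases "i < m") auto
    then show "a(k := 0) \<in> vecs k ?H" using a(3) by (auto simp: vecs_def)
  qed
  ultimately have "card (monic_vecs m k :: (nat \<Rightarrow> 'a) set) \<le> card (vecs k ?H)"
    by (metis card_inj_on_le finite finite_card_vecs(1))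
  then show ?thesis by (simp add: finite_card_vecs)
qed

definition lin_comb :: "nat \<Rightarrow> (nat \<Rightarrow> nat \<Rightarrow> 'a::field) \<Rightarrow> (nat \<Rightarrow> 'a) \<Rightarrow> nat \<Rightarrow> 'a" where
  "lin_comb m b a = (\<lambda>l. \<Sum>j<m. a j * b j l)"

lemma lin_comb_vecs:
  assumes "\<And>j. j < m \<Longrightarrow> b j \<in> vecs m UNIV"
  shows "lin_comb m b a \<in> vecs m UNIV"
  using assms by (auto simp: lin_comb_def vecs_def)

lemma lin_comb_prime_vecs:
  fixes b :: "nat \<Rightarrow> nat \<Rightarrow> 'a::{field,finite}"
  assumes "\<And>j. j < m \<Longrightarrow> b j \<in> vecs m prime_subfield" "a \<in> vecs m prime_subfield"
  shows "lin_comb m b a \<in> vecs m prime_subfield"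
  using assms by (auto simp: lin_comb_def vecs_def intro!: prime_subfield_sum prime_subfield_closed)

text \<open>Over the prime subfield an injective endomorphism is onto, so the standard basis lies in the
  span; hence the extension to the whole field is onto as well.\<close>
lemma bij_lin_comb:
  fixes b :: "nat \<Rightarrow> nat \<Rightarrow> 'a::{field,finite}"
  assumes b: "\<And>j. j < m \<Longrightarrow> b j \<in> vecs m prime_subfield"
    and indep: "\<And>k a. k < m \<Longrightarrow> a \<in> monic_vecs m k \<Longrightarrow> lin_comb m b a \<noteq> (\<lambda>_. 0)"
  shows "bij_betw (lin_comb m b) (vecs m UNIV) (vecs m UNIV)"
proof -
  let ?H = "prime_subfield :: 'a set"
  have bU: "\<And>j. j < m \<Longrightarrow> b j \<in> vecs m UNIV" using b vecs_mono[of ?H UNIV m] by auto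
  have "inj_on (lin_comb m b) (vecs m ?H)"
  proof (rule inj_onI, rule ccontr)
    fix a a' assume a: "a \<in> vecs m ?H" "a' \<in> vecs m ?H" "lin_comb m b a = lin_comb m b a'" "a \<noteq> a'"
    define e where "e j = a j - a' j" for j
    have eH: "e j \<in> ?H" for j
    proof -
      have "a j \<in> ?H" "a' j \<in> ?H"
        using a(1,2) prime_subfield_closed(1) by (cases "j < m"; auto simp: vecs_def)+
      then show ?thesis
        unfolding e_def by (metis add_uminus_conv_diff prime_subfield_closed(3) prime_subfield_uminus)
    qed
    have e0: "e j = 0" if "j \<ge> m" for j using a(1,2) that by (auto simp: e_def vecs_def)
    have fin: "finite {j. e j \<noteq> 0}"
      by (rule finite_subset[of _ "{..<m}"]) (use e0 in \<open>auto simp: not_le[symmetric]\<close>)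
    have ne: "{j. e j \<noteq> 0} \<noteq> {}" using a(4) by (auto simp: e_def fun_eq_iff)
    \<comment> \<open>Two coefficient vectors with the same image have a difference \<open>e\<close>
      in the kernel; dividing by its last nonzero entry gives a forbidden monic relation.\<close>
    define k where "k = Max {j. e j \<noteq> 0}"
    have k: "e k \<noteq> 0" using Max_in[OF fin ne] by (simp add: k_def)
    then have "k < m" using e0 not_le by blast
    have "e j = 0" if "j > k" for j
    proof (rule ccontr)
      assume "e j \<noteq> 0"
      then have "j \<le> k" using Max_ge[OF fin, of j] by (simp add: k_def)
      then show False using that by simp
    qed
    then have "(\<lambda>j. inverse (e k) * e j) \<in> monic_vecs m k"
      using k e0 eH by (auto simp: monic_vecs_def vecs_def intro!: prime_subfield_closed(4) prime_subfield_inverse)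
    moreover have "lin_comb m b (\<lambda>j. inverse (e k) * e j) = (\<lambda>_. 0)"
    proof
      fix l
      have "lin_comb m b (\<lambda>j. inverse (e k) * e j) l
          = inverse (e k) * (lin_comb m b a l - lin_comb m b a' l)"
        by (simp add: lin_comb_def e_def sum_distrib_left right_diff_distrib left_diff_distrib
            sum_subtractf mult.assoc)
      then show "lin_comb m b (\<lambda>j. inverse (e k) * e j) l = 0" by (simp add: a(3))
    qed
    ultimately show False using indep \<open>k < m\<close> by blast
  qed
  then have surjH: "lin_comb m b ` vecs m ?H = vecs m ?H"
    by (intro endo_inj_surj) (auto simp: finite_card_vecs lin_comb_prime_vecs b)
  define E :: "nat \<Rightarrow> nat \<Rightarrow> 'a" where "E k l = (if l = k then 1 else 0)" for k l
  have "\<exists>a. lin_comb m b a = E k" if "k < m" for k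
  proof -
    have "E k \<in> vecs m ?H" using that by (auto simp: E_def vecs_def intro: prime_subfield_closed)
    then show ?thesis using surjH by (metis imageE)
  qed
  then obtain A where A: "\<And>k. k < m \<Longrightarrow> lin_comb m b (A k) = E k" by metis
  have "vecs m UNIV \<subseteq> lin_comb m b ` vecs m UNIV"
  proof
    fix y :: "nat \<Rightarrow> 'a" assume y: "y \<in> vecs m UNIV"
    \<comment> \<open>The preimages \<open>A k\<close> of the standard basis vectors are combined
      with the coordinates of \<open>y\<close>, which now range over the whole field.\<close>
    define \<sigma> where "\<sigma> j = (if j < m then \<Sum>k<m. y k * A k j else 0)" for j
    have "lin_comb m b \<sigma> l = y l" for l
    proof -
      have "lin_comb m b \<sigma> l = (\<Sum>j<m. \<Sum>k<m. y k * (A k j * b j l))"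
        by (simp add: lin_comb_def \<sigma>_def sum_distrib_right mult.assoc)
      also have "\<dots> = (\<Sum>k<m. y k * lin_comb m b (A k) l)"
        by (subst sum.swap) (simp add: lin_comb_def sum_distrib_left)
      also have "\<dots> = (\<Sum>k<m. if k = l then y k else 0)"
        by (intro sum.cong) (auto simp: A E_def)
      also have "\<dots> = y l" using y by (auto simp: vecs_def)
      finally show ?thesis .
    qed
    moreover have "\<sigma> \<in> vecs m UNIV" by (auto simp: \<sigma>_def vecs_def)
    ultimately show "y \<in> lin_comb m b ` vecs m UNIV" by (metis ext image_eqI)
  qed
  moreover have "lin_comb m b ` vecs m UNIV \<subseteq> vecs m UNIV"
    using lin_comb_vecs[OF bU] by auto
  ultimately have "lin_comb m b ` vecs m UNIV = vecs m UNIV" by blast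
  then show ?thesis
    by (simp add: bij_betw_def finite_card_vecs eq_card_imp_inj_on)
qed

section \<open>Translations acting on the walk space\<close>

fun walk_dir :: "'a walk_choice \<Rightarrow> nat \<Rightarrow> nat \<Rightarrow> 'a" where
  "walk_dir (h0, h0', c) 0 = h0'"
| "walk_dir (h0, h0', c) (Suc i) = (case c i of (s, s', t, t', h) \<Rightarrow> h)"

text \<open>Translates the direction \<open>h'\<close> with index \<open>k\<close> by
  \<open>v\<close>. The cases mirror the storage of the walk: index 0 has its own component, while
  index \<open>Suc i\<close> sits in entry \<open>i\<close> of \<open>c\<close>.\<close>

fun shift_dir :: "nat \<Rightarrow> (nat \<Rightarrow> 'a::field) \<Rightarrow> 'a walk_choice \<Rightarrow> 'a walk_choice" where
  "shift_dir 0 v (h0, h0', c) = (h0, (\<lambda>l. h0' l + v l), c)"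
| "shift_dir (Suc i) v (h0, h0', c)
    = (h0, h0', c(i := case c i of (s, s', t, t', h) \<Rightarrow> (s, s', t, t', \<lambda>l. h l + v l)))"

text \<open>Only entries below \<open>m\<close> are changed, so that \<open>c\<close> stays
  extensional and the result remains in the walk space.\<close>

fun shift_step :: "nat \<Rightarrow> (nat \<Rightarrow> 'a::field) \<Rightarrow> 'a walk_choice \<Rightarrow> 'a walk_choice" where
  "shift_step m \<sigma> (h0, h0', c)
    = (h0, h0', \<lambda>i. if i < m then case c i of (s, s', t, t', h) \<Rightarrow> (s, s' + \<sigma> i, t, t', h) else c i)"

lemma finite_walk_space: "finite (walk_space m (H :: 'a::{field,finite} set))"
  unfolding walk_space_def by (intro finite_cartesian_product finite_PiE) (auto simp: finite_card_vecs)

lemma bij_betw_shift_step: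
  "bij_betw (shift_step m (\<sigma> :: nat \<Rightarrow> 'a::{field,finite})) (walk_space m H) (walk_space m H)"
proof (rule bij_betwI[where g = "shift_step m (\<lambda>i. - \<sigma> i)"])
  have *: "shift_step m \<sigma>' w \<in> walk_space m H" if "w \<in> walk_space m H" for \<sigma>' :: "nat \<Rightarrow> 'a" and w
  proof -
    obtain h0 h0' c where w: "w = (h0, h0', c)" by (metis prod_cases3)
    have c: "c \<in> PiE {..<m} (\<lambda>_. UNIV \<times> UNIV \<times> UNIV \<times> UNIV \<times> vecs m H)"
      using that by (simp add: w walk_space_def)
    have "(\<lambda>i. if i < m then case c i of (s, s', t, t', h) \<Rightarrow> (s, s' + \<sigma>' i, t, t', h) else c i)
        \<in> PiE {..<m} (\<lambda>_. UNIV \<times> UNIV \<times> UNIV \<times> UNIV \<times> vecs m H)"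
    proof (rule PiE_I)
      fix i assume "i \<in> {..<m}"
      then show "(if i < m then case c i of (s, s', t, t', h) \<Rightarrow> (s, s' + \<sigma>' i, t, t', h) else c i)
          \<in> UNIV \<times> UNIV \<times> UNIV \<times> UNIV \<times> vecs m H"
        using PiE_mem[OF c, of i] by (cases "c i") simp
    qed (use PiE_arb[OF c] in simp)
    then show ?thesis using that by (simp add: w walk_space_def)
  qed
  show "shift_step m \<sigma> \<in> walk_space m H \<rightarrow> walk_space m H"
    "shift_step m (\<lambda>i. - \<sigma> i) \<in> walk_space m H \<rightarrow> walk_space m H" using * by blast+
  show "shift_step m (\<lambda>i. - \<sigma> i) (shift_step m \<sigma> w) = w" for w
    by (cases w) (simp add: fun_eq_iff split: prod.split)
  show "shift_step m \<sigma> (shift_step m (\<lambda>i. - \<sigma> i) w) = w" for w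
    by (cases w) (simp add: fun_eq_iff split: prod.split)
qed

lemma bij_betw_shift_dir:
  fixes v :: "nat \<Rightarrow> 'a::{field,finite}"
  assumes "v \<in> vecs m prime_subfield" "k < m"
  shows "bij_betw (shift_dir k v) (walk_space m prime_subfield) (walk_space m prime_subfield)"
proof (rule bij_betwI[where g = "shift_dir k (\<lambda>i. - v i)"])
  have V: "(\<lambda>l. h l + v' l) \<in> vecs m prime_subfield"
    if "h \<in> vecs m prime_subfield" "v' \<in> vecs m prime_subfield" for h v' :: "nat \<Rightarrow> 'a"
    using that by (auto simp: vecs_def intro: prime_subfield_closed)
  have *: "shift_dir k v' w \<in> walk_space m prime_subfield"
    if v': "v' \<in> vecs m prime_subfield" and w: "w \<in> walk_space m prime_subfield" for v' :: "nat \<Rightarrow> 'a" and w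
  proof -
    let ?S = "UNIV \<times> UNIV \<times> UNIV \<times> UNIV \<times> vecs m (prime_subfield :: 'a set)"
    obtain h0 h0' c where w': "w = (h0, h0', c)" by (metis prod_cases3)
    have h: "h0 \<in> vecs m prime_subfield" "h0' \<in> vecs m prime_subfield" "c \<in> PiE {..<m} (\<lambda>_. ?S)"
      using w by (simp_all add: w' walk_space_def)
    show ?thesis
    proof (cases k)
      case 0
      show ?thesis using h V[OF h(2) v'] by (simp add: w' 0 walk_space_def)
    next
      case (Suc i)
      then have "i < m" using assms(2) by simp
      obtain s s' t t' h where ci: "c i = (s, s', t, t', h)" by (metis prod_cases5)
      have "h \<in> vecs m prime_subfield" using PiE_mem[OF h(3), of i] \<open>i < m\<close> ci by simp
      then have "(s, s', t, t', \<lambda>l. h l + v' l) \<in> ?S" using V[OF _ v'] by simp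
      then have "c(i := (s, s', t, t', \<lambda>l. h l + v' l)) \<in> PiE {..<m} (\<lambda>_. ?S)"
        using PiE_fun_upd[OF _ h(3), of _ i] \<open>i < m\<close> by (simp add: insert_absorb)
      then show ?thesis using h by (simp add: w' Suc ci walk_space_def)
    qed
  qed
  have "(\<lambda>i. - v i) \<in> vecs m prime_subfield"
    using assms(1) by (auto simp: vecs_def intro: prime_subfield_uminus)
  then show "shift_dir k v \<in> walk_space m prime_subfield \<rightarrow> walk_space m prime_subfield"
    "shift_dir k (\<lambda>i. - v i) \<in> walk_space m prime_subfield \<rightarrow> walk_space m prime_subfield"
    using * assms(1) by blast+
  have inv: "shift_dir k v2 (shift_dir k v1 w) = w" if "\<And>l. v1 l + v2 l = 0" for v1 v2 :: "nat \<Rightarrow> 'a" and w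
  proof -
    obtain h0 h0' c where w: "w = (h0, h0', c)" by (metis prod_cases3)
    show ?thesis
    proof (cases k)
      case (Suc i)
      obtain s s' t t' h where ci: "c i = (s, s', t, t', h)" by (metis prod_cases5)
      show ?thesis by (simp add: w Suc ci add.assoc that fun_upd_idem)
    qed (simp add: w add.assoc that)
  qed
  show "shift_dir k (\<lambda>i. - v i) (shift_dir k v w) = w" for w by (rule inv) simp
  show "shift_dir k v (shift_dir k (\<lambda>i. - v i) w) = w" for w by (rule inv) simp
qed

lemma walk_dir_shift_dir:
  "walk_dir (shift_dir k v w) j = (if j = k then \<lambda>l. walk_dir w j l + v l else walk_dir w j)"
  by (cases w; cases k; cases j) (auto split: prod.splits)

lemma walk_dir_vecs:
  assumes "w \<in> walk_space m H" "j < m"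
  shows "walk_dir w j \<in> vecs m H"
proof -
  obtain h0 h0' c where w: "w = (h0, h0', c)" by (metis prod_cases3)
  show ?thesis
  proof (cases j)
    case (Suc i)
    have "c \<in> PiE {..<m} (\<lambda>_. UNIV \<times> UNIV \<times> UNIV \<times> UNIV \<times> vecs m H)"
      using assms by (simp add: w walk_space_def)
    from PiE_mem[OF this, of i] have "c i \<in> UNIV \<times> UNIV \<times> UNIV \<times> UNIV \<times> vecs m H"
      using assms(2) Suc by simp
    then show ?thesis by (auto simp: w Suc)
  qed (use assms in \<open>auto simp: w walk_space_def\<close>)
qed

text \<open>The scalars \<open>s'\<close> enter only the base point, so the shift translates it by a
  combination of the fresh directions and leaves both directions of the plane alone. The last
  conjunct identifies the third component of the plane, which the induction needs.\<close>

lemma walk_plane_shift_step: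
  assumes "i \<le> m"
  shows "walk_plane x (shift_step m \<sigma> w) i = (case walk_plane x w i of (a, h, h') \<Rightarrow>
      (\<lambda>l. a l + lin_comb i (walk_dir w) \<sigma> l, h, walk_dir w i))
    \<and> snd (snd (walk_plane x w i)) = walk_dir w i"
  using assms
proof (induction i)
  case 0
  show ?case by (cases w) (simp add: lin_comb_def)
next
  case (Suc i)
  obtain h0 h0' c where w: "w = (h0, h0', c)" by (metis prod_cases3)
  obtain s s' t t' hn where ci: "c i = (s, s', t, t', hn)" by (metis prod_cases5)
  obtain a h h' where P: "walk_plane x w i = (a, h, h')" by (metis prod_cases3)
  from Suc have "walk_plane x (shift_step m \<sigma> w) i
      = (\<lambda>l. a l + lin_comb i (walk_dir w) \<sigma> l, h, h')" "walk_dir w i = h'"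
    by (auto simp: P)
  then show ?case
    using Suc.prems P by (simp add: w ci lin_comb_def fun_eq_iff algebra_simps)
qed

text \<open>Since \<open>a k = 1\<close>, translating direction \<open>k\<close> by \<open>v\<close>
  translates the whole combination by \<open>v\<close>. Hence at most one \<open>v\<close> makes the
  relation hold, and averaging over all \<open>v\<close> bounds its probability by
  \<open>1 / p ^ m\<close>, where \<open>p\<close> is the size of the prime subfield.\<close>

lemma card_monic_relation:
  fixes a :: "nat \<Rightarrow> 'a::{field,finite}" and m :: nat
  assumes "k < m" "a \<in> monic_vecs m k"
  defines "W \<equiv> walk_space m (prime_subfield :: 'a set)"
  shows "card (prime_subfield :: 'a set) ^ m * card {w\<in>W. lin_comb m (walk_dir w) a = (\<lambda>_. 0)} \<le> card W"
proof -
  let ?V = "vecs m (prime_subfield :: 'a set)"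
  have "card ?V * card {w\<in>W. lin_comb m (walk_dir w) a = (\<lambda>_. 0)}
      = (\<Sum>w\<in>W. card {v\<in>?V. lin_comb m (walk_dir (shift_dir k v w)) a = (\<lambda>_. 0)})"
    unfolding W_def
    by (intro card_mult_shift finite_walk_space bij_betw_shift_dir assms(1)) (auto simp: finite_card_vecs)
  also have "\<dots> \<le> (\<Sum>w\<in>W. 1)"
  proof (rule sum_mono)
    fix w assume "w \<in> W"
    have "lin_comb m (walk_dir (shift_dir k v w)) a l = lin_comb m (walk_dir w) a l + v l" for v l
    proof -
      have "lin_comb m (walk_dir (shift_dir k v w)) a l
          = (\<Sum>j<m. a j * walk_dir w j l + (if j = k then v l else 0))"
        unfolding lin_comb_def using assms(2)
        by (intro sum.cong) (auto simp: walk_dir_shift_dir monic_vecs_def algebra_simps)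
      then show ?thesis using assms(1) by (simp add: sum.distrib lin_comb_def)
    qed
    then have "v = (\<lambda>l. - lin_comb m (walk_dir w) a l)"
      if "lin_comb m (walk_dir (shift_dir k v w)) a = (\<lambda>_. 0)" for v
      using that by (metis (no_types, lifting) add_eq_0_iff ext)
    then have "{v\<in>?V. lin_comb m (walk_dir (shift_dir k v w)) a = (\<lambda>_. 0)}
        \<subseteq> {\<lambda>l. - lin_comb m (walk_dir w) a l}" by blast
    then have "card {v\<in>?V. lin_comb m (walk_dir (shift_dir k v w)) a = (\<lambda>_. 0)}
        \<le> card {\<lambda>l. - lin_comb m (walk_dir w) a l}"
      by (rule card_mono[rotated]) simp
    also have "\<dots> = 1" by simp
    finally show "card {v\<in>?V. lin_comb m (walk_dir (shift_dir k v w)) a = (\<lambda>_. 0)} \<le> 1" .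
  qed
  finally show ?thesis by (simp add: finite_card_vecs)
qed

text \<open>A geometric sum bound for the union over monic relations; it is the source of the 2 in
  the error term 2/|H|.\<close>

lemma mult_sum_powers_le:
  fixes p :: nat
  assumes "p \<ge> 2"
  shows "p * (\<Sum>k<m. p ^ k) \<le> 2 * p ^ m"
proof (induction m)
  case (Suc m)
  have "2 * p ^ m \<le> p * p ^ m" using assms by simp
  then have "p * (\<Sum>k<m. p ^ k) + p * p ^ m \<le> p * p ^ m + p * p ^ m"
    using Suc by linarith
  then show ?case by (simp add: distrib_left mult_2)
qed simp

text \<open>A relation among the directions can be normalized to be monic, and there are at most
  \<open>\<Sum>k<m. p ^ k\<close> monic ones.\<close>
lemma card_dependent:
  fixes m :: nat
  defines "W \<equiv> walk_space m (prime_subfield :: 'a::{field,finite} set)"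
  shows "card (prime_subfield :: 'a set)
      * card {w\<in>W. \<exists>k<m. \<exists>a\<in>monic_vecs m k. lin_comb m (walk_dir w) a = (\<lambda>_. 0)} \<le> 2 * card W"
proof -
  let ?p = "card (prime_subfield :: 'a set)"
  let ?R = "\<lambda>a. {w\<in>W. lin_comb m (walk_dir w) a = (\<lambda>_. 0)}"
  let ?M = "\<lambda>k. monic_vecs m k :: (nat \<Rightarrow> 'a) set"
  let ?D = "{w\<in>W. \<exists>k<m. \<exists>a\<in>monic_vecs m k. lin_comb m (walk_dir w) a = (\<lambda>_. 0)}"
  have p: "?p \<ge> 2" by (rule card_prime_subfield_ge_2)
  have finM: "finite (?M k)" for k
    by (rule finite_subset[of _ "vecs m prime_subfield"]) (auto simp: monic_vecs_def finite_card_vecs)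
  have "?D = (\<Union>k<m. \<Union>a\<in>?M k. ?R a)" by auto
  then have "card ?D \<le> (\<Sum>k<m. card (\<Union>a\<in>?M k. ?R a))"
    by (simp only: card_UN_le finite_lessThan)
  also have "\<dots> \<le> (\<Sum>k<m. \<Sum>a\<in>?M k. card (?R a))"
    by (intro sum_mono card_UN_le finM)
  finally have "?p ^ m * card ?D \<le> (\<Sum>k<m. \<Sum>a\<in>?M k. ?p ^ m * card (?R a))"
    by (simp flip: sum_distrib_left)
  also have "\<dots> \<le> (\<Sum>k<m. \<Sum>a\<in>?M k. card W)"
    unfolding W_def by (intro sum_mono card_monic_relation) auto
  also have "\<dots> = (\<Sum>k<m. card (?M k)) * card W" by (simp add: sum_distrib_right)
  also have "\<dots> \<le> (\<Sum>k<m. ?p ^ k) * card W"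
    by (intro mult_right_mono sum_mono card_monic_vecs) auto
  finally have "?p * (?p ^ m * card ?D) \<le> (?p * (\<Sum>k<m. ?p ^ k)) * card W" by simp
  also have "\<dots> \<le> (2 * ?p ^ m) * card W"
    by (intro mult_right_mono mult_sum_powers_le p) auto
  finally have "?p ^ m * (?p * card ?D) \<le> ?p ^ m * (2 * card W)" by (simp add: mult_ac)
  then show ?thesis using p by simp
qed

fun plane_pt :: "(nat \<Rightarrow> 'a::field) \<times> (nat \<Rightarrow> 'a) \<times> (nat \<Rightarrow> 'a) \<Rightarrow> 'a \<times> 'a \<Rightarrow> nat \<Rightarrow> 'a" where
  "plane_pt (a, h, h') (t, s) = (\<lambda>l. a l + t * h l + s * h' l)"

lemma restr_plane_pt: "restr f P z = f (plane_pt P z)"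
  by (cases P; cases z) (simp add: restr_def)

text \<open>Shifting the step lengths along the directions \<open>h'\<^sub>i\<close> is a measure-preserving action on the
  walks; averaging over it makes the final point uniform as soon as these directions are
  independent.\<close>
lemma walk_mixing:
  fixes B :: "(nat \<Rightarrow> 'a::{field,finite}) set" and m :: nat
  assumes "finite B"
  defines "W \<equiv> walk_space m (prime_subfield :: 'a set)"
    and "p \<equiv> card (prime_subfield :: 'a set)" and "q \<equiv> card (UNIV :: 'a set)"
  shows "p * q ^ m * card {w\<in>W. plane_pt (walk_plane x w m) z \<in> B} \<le> card W * (p * card B + 2 * q ^ m)"
proof -
  let ?D = "{w\<in>W. \<exists>k<m. \<exists>a\<in>monic_vecs m k. lin_comb m (walk_dir w) a = (\<lambda>_. 0)}"
  let ?V = "vecs m (UNIV :: 'a set)"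
  let ?C = "\<lambda>w. {\<sigma>\<in>?V. plane_pt (walk_plane x (shift_step m \<sigma> w) m) z \<in> B}"
  have finW: "finite W" unfolding W_def by (rule finite_walk_space)
  have cV: "card ?V = q ^ m" by (simp add: finite_card_vecs q_def)
  have "q ^ m * card {w\<in>W. plane_pt (walk_plane x w m) z \<in> B} = (\<Sum>w\<in>W. card (?C w))"
    unfolding cV[symmetric] W_def
    by (intro card_mult_shift finite_walk_space bij_betw_shift_step) (auto simp: finite_card_vecs)
  \<comment> \<open>For dependent directions every shift is counted; otherwise distinct shifts give
    distinct final points, so at most \<open>card B\<close> of them land in
    \<open>B\<close>.\<close>
  also have "\<dots> \<le> (\<Sum>w\<in>W. card B + (if w \<in> ?D then q ^ m else 0))"
  proof (rule sum_mono)
    fix w assume w: "w \<in> W"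
    show "card (?C w) \<le> card B + (if w \<in> ?D then q ^ m else 0)"
    proof (cases "w \<in> ?D")
      case True
      have "card (?C w) \<le> card ?V" by (intro card_mono) (auto simp: finite_card_vecs)
      then show ?thesis using True by (simp add: cV)
    next
      case False
      let ?L = "lin_comb m (walk_dir w)"
      have "bij_betw ?L ?V ?V"
        by (rule bij_lin_comb) (use w False in \<open>auto simp: W_def intro: walk_dir_vecs\<close>)
      then have inj: "inj_on ?L ?V" by (rule bij_betw_imp_inj_on)
      have pt: "plane_pt (walk_plane x (shift_step m \<sigma> w) m) z
          = (\<lambda>l. plane_pt (walk_plane x w m) z l + ?L \<sigma> l)" for \<sigma>
      proof -
        obtain a h h' where P: "walk_plane x w m = (a, h, h')" by (metis prod_cases3)
        then show ?thesis
          using walk_plane_shift_step[of m m x \<sigma> w]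
          by (cases z) (auto simp: fun_eq_iff algebra_simps)
      qed
      have "inj_on (\<lambda>\<sigma>. plane_pt (walk_plane x (shift_step m \<sigma> w) m) z) (?C w)"
      proof (rule inj_onI)
        fix \<sigma> \<sigma>' assume *: "\<sigma> \<in> ?C w" "\<sigma>' \<in> ?C w"
          "plane_pt (walk_plane x (shift_step m \<sigma> w) m) z = plane_pt (walk_plane x (shift_step m \<sigma>' w) m) z"
        have "?L \<sigma> = ?L \<sigma>'" using *(3) unfolding pt by (auto simp: fun_eq_iff)
        then show "\<sigma> = \<sigma>'" using inj *(1,2) by (auto dest: inj_onD)
      qed
      then have "card (?C w) \<le> card B" by (rule card_inj_on_le) (auto simp: assms(1))
      then show ?thesis by simp
    qed
  qed
  also have "\<dots> = card W * card B + card ?D * q ^ m"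
    using finW by (simp add: sum.distrib sum.If_cases Int_def)
  finally have "p * (q ^ m * card {w\<in>W. plane_pt (walk_plane x w m) z \<in> B})
      \<le> p * (card W * card B + card ?D * q ^ m)" by (rule mult_left_mono) simp
  also have "\<dots> = card W * p * card B + (p * card ?D) * q ^ m" by (simp add: algebra_simps)
  also have "\<dots> \<le> card W * p * card B + (2 * card W) * q ^ m"
    unfolding p_def W_def by (intro add_left_mono mult_right_mono card_dependent) auto
  finally show ?thesis by (simp add: algebra_simps)
qed

subsection \<open>Soundness of the walk\<close>

text \<open>Merges the two kinds of test: weight on the origin for the initial plane, weight on the
  first axis for all later ones.\<close>

definition walk_fails :: "nat \<Rightarrow> real \<Rightarrow> ((nat \<Rightarrow> 'a::{field,finite}) \<Rightarrow> 'a) \<Rightarrow> (nat \<Rightarrow> 'a)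
    \<Rightarrow> 'a walk_choice \<Rightarrow> nat \<Rightarrow> bool" where
  "walk_fails d \<rho> f x w j \<longleftrightarrow>
    \<rho> \<le> wdist_set (if j = 0 then {(0, 0)} else {(t, 0) | t. True}) (restr f (walk_plane x w j)) (RM2 d)"

text \<open>The invariant of the walk: each step preserves it with probability at least \<open>1 - 4/q\<close>.\<close>
definition walk_off :: "nat \<Rightarrow> real \<Rightarrow> ((nat \<Rightarrow> 'a::{field,finite}) \<Rightarrow> 'a) \<Rightarrow> ((nat \<Rightarrow> 'a) \<Rightarrow> 'a)
    \<Rightarrow> (nat \<Rightarrow> 'a) \<Rightarrow> 'a walk_choice \<Rightarrow> nat \<Rightarrow> bool" where
  "walk_off d \<rho> f g x w i \<longleftrightarrow> (\<exists>j\<le>i. walk_fails d \<rho> f x w j)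
    \<or> (\<exists>Q\<in>RM2 d. real (card {z. restr f (walk_plane x w i) z \<noteq> Q z})
          < 2 * \<rho> * real (card (UNIV :: 'a set)) ^ 2
        \<and> Q \<noteq> restr g (walk_plane x w i))"

lemma RM2_not_empty: "RM2 d \<noteq> {}"
  using RM2_zero by blast

lemma walk_off_0:
  assumes "f x \<noteq> g x" "\<rho> \<le> 1 / 2"
  shows "walk_off d \<rho> f g x (h0, h0', c) 0"
proof (cases "walk_fails d \<rho> f x (h0, h0', c) 0")
  case False
  let ?u = "restr f (x, h0, h0')"
  have "wdist_set {(0, 0)} ?u (RM2 d) < \<rho>" using False by (simp add: walk_fails_def)
  then obtain Q where Q: "Q \<in> RM2 d" "wdist {(0, 0)} ?u Q < \<rho>"
    using wdist_set_lessD RM2_not_empty by blast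
  have "Q (0, 0) = f x" using wdist_origin_less[OF Q(2) assms(2)] by (simp add: restr_def)
  moreover have "restr g (x, h0, h0') (0, 0) = g x" by (simp add: restr_def)
  ultimately have "Q \<noteq> restr g (x, h0, h0')" using assms(1) by auto
  then show ?thesis using Q wdist_less_card[OF Q(2)] by (auto simp: walk_off_def)
qed (auto simp: walk_off_def)

lemma walk_fails_cong:
  assumes "\<And>k. k < j \<Longrightarrow> c k = c' k"
  shows "walk_fails d \<rho> f x (h0, h0', c) j = walk_fails d \<rho> f x (h0, h0', c') j"
  unfolding walk_fails_def using walk_plane_cong[of j c c' x h0 h0'] assms by simp

text \<open>A test that has failed stays failed, since it depends on earlier choices only. Otherwise
  \<open>step_count\<close> leaves at most \<open>4 * q ^ 3\<close> of the \<open>q ^ 4\<close>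
  scalar quadruples as bad, whatever fresh direction is drawn from \<open>V\<close>.\<close>

lemma walk_off_step:
  fixes f g :: "(nat \<Rightarrow> 'a::{field,finite}) \<Rightarrow> 'a" and \<rho> :: real and d m i :: nat and V :: "(nat \<Rightarrow> 'a) set"
  defines "q \<equiv> real (card (UNIV :: 'a set))"
  defines "\<delta> \<equiv> 1 - real d / q"
  defines "S \<equiv> (UNIV :: 'a set) \<times> (UNIV :: 'a set) \<times> (UNIV :: 'a set) \<times> (UNIV :: 'a set) \<times> V"
  assumes "g \<in> RM m d" "x \<in> vecs m UNIV" "h0 \<in> vecs m UNIV" "h0' \<in> vecs m UNIV"
    and V: "V \<subseteq> vecs m UNIV"
    and "\<rho> \<le> \<delta> / 8" "\<delta> \<ge> 3 / 4"
    and c: "c \<in> PiE {..<i} (\<lambda>_. S)"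
    and off: "walk_off d \<rho> f g x (h0, h0', c) i"
  shows "(1 - 4 / q) * real (card S) \<le> real (card {y\<in>S. walk_off d \<rho> f g x (h0, h0', c(i := y)) (Suc i)})"
proof -
  have q: "q > 0" by (simp add: q_def card_gt_0_iff)
  have finV: "finite V" by (rule finite_subset[OF V]) (simp add: finite_card_vecs)
  then have finS: "finite S" by (simp add: S_def)
  have cS: "real (card S) = q ^ 4 * real (card V)"
    by (simp add: S_def card_cartesian_product q_def power4_eq_xxxx)
  let ?P = "walk_plane x (h0, h0', c) i"
  have P: "walk_plane x (h0, h0', c(i := y)) i = ?P" for y by (rule walk_plane_cong) simp
  let ?N = "{y\<in>S. walk_off d \<rho> f g x (h0, h0', c(i := y)) (Suc i)}"
  show ?thesis
  proof (cases "\<exists>j\<le>i. walk_fails d \<rho> f x (h0, h0', c) j")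
    case True
    then obtain j where j: "j \<le> i" "walk_fails d \<rho> f x (h0, h0', c) j" by blast
    have "walk_fails d \<rho> f x (h0, h0', c(i := y)) j" for y
      using walk_fails_cong[of j "c(i := y)" c] j by auto
    then have "?N = S" using j(1) by (auto simp: walk_off_def intro: le_SucI)
    moreover have "(1 - 4 / q) * real (card S) \<le> 1 * real (card S)"
      using q by (intro mult_right_mono) auto
    ultimately show ?thesis by simp
  next
    case False
    then obtain Q where Q: "Q \<in> RM2 d" "real (card {z. restr f ?P z \<noteq> Q z}) < 2 * \<rho> * q\<^sup>2"
        "Q \<noteq> restr g ?P"
      using off unfolding walk_off_def q_def by blast
    have g: "restr g ?P \<in> RM2 d"
    proof (rule restr_walk_plane_RM2[OF assms(4-7)])
      fix j assume "j < i"
      then have "c j \<in> S" using PiE_mem[OF c] by simp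
      also have "S \<subseteq> UNIV \<times> UNIV \<times> UNIV \<times> UNIV \<times> vecs m UNIV"
        unfolding S_def by (intro Sigma_mono order_refl V)
      finally show "c j \<in> UNIV \<times> UNIV \<times> UNIV \<times> UNIV \<times> vecs m UNIV" .
    qed
    define bad where "bad = {w. \<exists>R\<in>RM2 d. real (card {r. restr f ?P (line_pt w r) \<noteq> R (r, 0)}) < 2 * \<rho> * q
      \<and> (\<forall>r. R (r, 0) = restr g ?P (line_pt w r))}"
    have bad: "real (card bad) \<le> 4 * q ^ 3" 
      unfolding bad_def q_def
      by (rule step_count[OF Q(1) g Q(3)]) (use Q(2) assms(9,10) in \<open>simp_all add: q_def \<delta>_def\<close>)
    \<comment> \<open>The map only regroups nested pairs: the bad set consists of quadruples,
      whereas an element of \<open>S\<close> also carries the fresh direction.\<close>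
    have sub: "(\<lambda>((s, s', t, t'), h). (s, s', t, t', h)) ` ((- bad) \<times> V) \<subseteq> ?N"
    proof (rule image_subsetI)
      fix y assume "y \<in> (- bad) \<times> V"
      moreover obtain s s' t t' h where y: "y = ((s, s', t, t'), h)" by (metis prod.exhaust)
      ultimately have nb: "(s, s', t, t') \<notin> bad" and h: "h \<in> V" by auto
      let ?w = "(h0, h0', c(i := (s, s', t, t', h)))"
      let ?P' = "walk_plane x ?w (Suc i)"
      have axis: "restr f' ?P' (r, 0) = restr f' ?P (line_pt (s, s', t, t') r)" for f' :: "(nat \<Rightarrow> 'a) \<Rightarrow> 'a" and r
        using restr_walk_plane_Suc_axis[of "c(i := (s, s', t, t', h))" i s s' t t' h f' x h0 h0' r] P by simp
      have "walk_off d \<rho> f g x ?w (Suc i)"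
      proof (cases "walk_fails d \<rho> f x ?w (Suc i)")
        case False
        then have "wdist_set {(t, 0) | t. True} (restr f ?P') (RM2 d) < \<rho>"
          by (simp add: walk_fails_def not_le)
        then obtain R where R: "R \<in> RM2 d" "wdist {(t, 0) | t. True} (restr f ?P') R < \<rho>"
          using wdist_set_lessD RM2_not_empty by blast
        have "real (card {r. restr f ?P (line_pt (s, s', t, t') r) \<noteq> R (r, 0)}) < 2 * \<rho> * q"
          using wdist_axis_less[OF R(2)] unfolding axis q_def .
        \<comment> \<open>The polynomial \<open>R\<close> accepted by the new test is close to
          \<open>f\<close> on the line, so if it agreed with \<open>g\<close> there the quadruple
          would be bad.\<close>
        then obtain r where "R (r, 0) \<noteq> restr g ?P (line_pt (s, s', t, t') r)"
          using nb R(1) unfolding bad_def by blast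
        then have "R \<noteq> restr g ?P'" by (metis axis)
        then show ?thesis
          using R(1) wdist_less_card[OF R(2)] unfolding walk_off_def by blast
      qed (auto simp: walk_off_def)
      then show "(\<lambda>((s, s', t, t'), h). (s, s', t, t', h)) y \<in> ?N"
        using h by (simp add: S_def y)
    qed
    have inj: "inj_on (\<lambda>((s, s', t, t'), h). (s, s', t, t', h)) A" for A :: "(('a \<times> 'a \<times> 'a \<times> 'a) \<times> (nat \<Rightarrow> 'a)) set"
      by (rule inj_on_inverseI[where g = "\<lambda>(s, s', t, t', h). ((s, s', t, t'), h)"])
         (simp split: prod.split)
    have "real (card (- bad)) = q ^ 4 - real (card bad)"
    proof -
      have "card (UNIV :: ('a \<times> 'a \<times> 'a \<times> 'a) set) = card bad + card (- bad)"
        by (subst card_Un_disjoint[symmetric]) auto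
      moreover have "real (card (UNIV :: ('a \<times> 'a \<times> 'a \<times> 'a) set)) = q ^ 4"
        by (simp add: q_def power4_eq_xxxx)
      ultimately show ?thesis by simp
    qed
    then have "q ^ 4 - 4 * q ^ 3 \<le> real (card (- bad))" using bad by simp
    moreover have "(1 - 4 / q) * q ^ 4 = q ^ 4 - 4 * q ^ 3"
      using q by (simp add: field_simps power4_eq_xxxx power3_eq_cube)
    ultimately have "(1 - 4 / q) * q ^ 4 * real (card V) \<le> real (card (- bad)) * real (card V)"
      by (intro mult_right_mono) auto
    also have "\<dots> = real (card ((\<lambda>((s, s', t, t'), h). (s, s', t, t', h)) ` ((- bad) \<times> V)))"
      by (simp add: card_image[OF inj] card_cartesian_product)
    also have "\<dots> \<le> real (card ?N)"
      using finS by (intro of_nat_mono card_mono sub) auto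
    finally show ?thesis by (simp add: cS mult.assoc)
  qed
qed

text \<open>For fixed initial directions the steps form a sequential choice with success rate
  \<open>1 - 4 / q\<close>; the bounds are then summed over these directions. The condition
  \<open>q \<ge> 4\<close> keeps the rate nonnegative.\<close>

lemma card_walk_off:
  fixes f g :: "(nat \<Rightarrow> 'a::{field,finite}) \<Rightarrow> 'a" and \<rho> :: real and d m :: nat and H :: "'a set"
  defines "q \<equiv> real (card (UNIV :: 'a set))"
  defines "\<delta> \<equiv> 1 - real d / q"
  assumes "g \<in> RM m d" "x \<in> vecs m UNIV" "f x \<noteq> g x"
    and "\<rho> \<le> \<delta> / 8" "\<delta> \<ge> 3 / 4" "q \<ge> 4"
  shows "(1 - 4 / q) ^ m * real (card (walk_space m H)) \<le> real (card {w\<in>walk_space m H. walk_off d \<rho> f g x w m})"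
proof -
  let ?V = "vecs m H"
  let ?S = "(UNIV :: 'a set) \<times> (UNIV :: 'a set) \<times> (UNIV :: 'a set) \<times> (UNIV :: 'a set) \<times> ?V"
  let ?C = "\<lambda>h0 h0'. {c \<in> PiE {..<m} (\<lambda>_. ?S). walk_off d \<rho> f g x (h0, h0', c) m}"
  have finV: "finite ?V" by (simp add: finite_card_vecs)
  have "finite (PiE {..<m} (\<lambda>_. ?S))"
    by (intro finite_PiE finite_cartesian_product finV) auto
  then have finC: "finite (?C h0 h0')" for h0 h0' by simp
  have "\<delta> \<le> 1" by (simp add: \<delta>_def q_def)
  then have \<rho>: "\<rho> \<le> 1 / 2" using assms(6) by simp
  have VU: "?V \<subseteq> vecs m UNIV" by (rule vecs_mono) simp
  have step: "(1 - 4 / q) ^ m * real (card ?S) ^ m \<le> real (card (?C h0 h0'))"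
    if h: "h0 \<in> ?V" "h0' \<in> ?V" for h0 h0'
  proof (rule sequential_count[where m = m])
    show "walk_off d \<rho> f g x (h0, h0', \<lambda>_. undefined) 0"
      using assms(5) \<rho> by (rule walk_off_0)
    show "0 \<le> 1 - 4 / q" using assms(8) by simp
    show "(1 - 4 / q) * real (card ?S)
        \<le> real (card {y \<in> ?S. walk_off d \<rho> f g x (h0, h0', c(i := y)) (Suc i)})"
      if "c \<in> PiE {..<i} (\<lambda>_. ?S)" "walk_off d \<rho> f g x (h0, h0', c) i" for i c
      unfolding q_def
      by (rule walk_off_step[where m = m])
         (use assms h VU that in \<open>auto simp: q_def \<delta>_def\<close>)
  qed (use finV in auto)
  have "(1 - 4 / q) ^ m * real (card (walk_space m H))
      = (\<Sum>h0\<in>?V. \<Sum>h0'\<in>?V. (1 - 4 / q) ^ m * real (card ?S) ^ m)"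
    by (simp add: walk_space_def card_cartesian_product card_PiE)
  also have "\<dots> \<le> (\<Sum>h0\<in>?V. \<Sum>h0'\<in>?V. real (card (?C h0 h0')))"
    by (intro sum_mono step)
  also have "\<dots> = real (card (Sigma ?V (\<lambda>h0. Sigma ?V (?C h0))))"
    using finV finC by (simp add: card_SigmaI)
  also have "Sigma ?V (\<lambda>h0. Sigma ?V (?C h0)) = {w\<in>walk_space m H. walk_off d \<rho> f g x w m}"
    by (auto simp: walk_space_def)
  finally show ?thesis .
qed

lemma walk_plane_in_vecs:
  assumes "x \<in> vecs m UNIV" "w \<in> walk_space m H" "i \<le> m"
  shows "walk_plane x w i \<in> vecs m UNIV \<times> vecs m UNIV \<times> vecs m UNIV"
proof -
  obtain h0 h0' c where w: "w = (h0, h0', c)" by (metis prod_cases3)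
  have HU: "vecs m H \<subseteq> vecs m UNIV" by (rule vecs_mono) simp
  have c: "c \<in> PiE {..<m} (\<lambda>_. UNIV \<times> UNIV \<times> UNIV \<times> UNIV \<times> vecs m H)"
    and h: "h0 \<in> vecs m UNIV" "h0' \<in> vecs m UNIV"
    using assms(2) HU by (simp_all add: w walk_space_def subsetD)
  have "c j \<in> UNIV \<times> UNIV \<times> UNIV \<times> UNIV \<times> vecs m UNIV" if "j < i" for j
  proof -
    have "c j \<in> UNIV \<times> UNIV \<times> UNIV \<times> UNIV \<times> vecs m H"
      using PiE_mem[OF c, of j] that assms(3) by simp
    also have "\<dots> \<subseteq> UNIV \<times> UNIV \<times> UNIV \<times> UNIV \<times> vecs m UNIV"
      by (intro Sigma_mono order_refl HU)
    finally show ?thesis .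
  qed
  then show ?thesis unfolding w by (intro walk_plane_vecs assms(1) h)
qed

text \<open>Markov's inequality for the number of points of the final plane where \<open>f\<close>
  and \<open>g\<close> differ. Its total over all walks is computed point by point, and
  \<open>walk_mixing\<close> bounds each plane coordinate \<open>z\<close> separately.\<close>

lemma card_final_plane_far:
  fixes f g :: "(nat \<Rightarrow> 'a::{field,finite}) \<Rightarrow> 'a" and m :: nat and \<tau> \<alpha> :: real
  defines "q \<equiv> real (card (UNIV :: 'a set))"
    and "W \<equiv> walk_space m (prime_subfield :: 'a set)"
    and "p \<equiv> real (card (prime_subfield :: 'a set))"
  assumes "x \<in> vecs m UNIV" "reldist m f g \<le> \<tau>"
  shows "\<alpha> * real (card {w\<in>W. \<alpha> * q\<^sup>2 \<le>
      real (card {z. restr f (walk_plane x w m) z \<noteq> restr g (walk_plane x w m) z})})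
    \<le> (\<tau> + 2 / p) * real (card W)"
proof -
  let ?V = "vecs m (UNIV :: 'a set)"
  let ?N = "\<lambda>w. {z. restr f (walk_plane x w m) z \<noteq> restr g (walk_plane x w m) z}"
  let ?Z = "{w\<in>W. \<alpha> * q\<^sup>2 \<le> real (card (?N w))}"
  define B where "B = {y\<in>?V. f y \<noteq> g y}"
  have finB: "finite B" unfolding B_def by (simp add: finite_card_vecs)
  have finW: "finite W" unfolding W_def by (rule finite_walk_space)
  have q: "q > 0" by (simp add: q_def card_gt_0_iff)
  have p: "p > 0" using card_prime_subfield_ge_2[where 'a = 'a] by (simp add: p_def)
  have B: "real (card B) \<le> \<tau> * q ^ m"
    using assms(5) q by (simp add: reldist_def B_def finite_card_vecs q_def field_simps)
  have pt: "real (card {w\<in>W. plane_pt (walk_plane x w m) z \<in> B}) \<le> (\<tau> + 2 / p) * real (card W)" for z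
  proof -
    have "p * q ^ m * real (card {w\<in>W. plane_pt (walk_plane x w m) z \<in> B})
        \<le> real (card W) * (p * real (card B) + 2 * q ^ m)"
      using walk_mixing[OF finB, of m x z, folded W_def] unfolding p_def q_def
      by (metis (mono_tags, lifting) of_nat_add of_nat_le_iff of_nat_mult of_nat_numeral of_nat_power)
    also have "\<dots> \<le> real (card W) * (p * (\<tau> * q ^ m) + 2 * q ^ m)"
      using B p by (intro mult_left_mono add_right_mono) auto
    also have "\<dots> = p * q ^ m * ((\<tau> + 2 / p) * real (card W))"
      using p by (simp add: field_simps)
    finally show ?thesis
      using p q by (simp only: mult_le_cancel_left_pos mult_pos_pos zero_less_power)
  qed
  have ind: "real (card {x\<in>A. P x}) = (\<Sum>x\<in>A. if P x then 1 else 0)" if "finite A" for A :: "'z set" and P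
    using that by (simp add: sum.If_cases Int_def)
  have "q\<^sup>2 * (\<alpha> * real (card ?Z)) = (\<Sum>w\<in>?Z. \<alpha> * q\<^sup>2)" by simp
  also have "\<dots> \<le> (\<Sum>w\<in>?Z. real (card (?N w)))" by (intro sum_mono) auto
  also have "\<dots> \<le> (\<Sum>w\<in>W. real (card (?N w)))" using finW by (intro sum_mono2) auto
  also have "\<dots> \<le> (\<Sum>w\<in>W. real (card {z\<in>UNIV. plane_pt (walk_plane x w m) z \<in> B}))"
  proof (intro sum_mono of_nat_mono card_mono)
    fix w assume "w \<in> W"
    then have "walk_plane x w m \<in> ?V \<times> ?V \<times> ?V"
      unfolding W_def by (intro walk_plane_in_vecs assms(4)) auto
    then have "plane_pt (walk_plane x w m) z \<in> ?V" for z
      by (cases "walk_plane x w m"; cases z) (auto simp: vecs_def)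
    then show "?N w \<subseteq> {z\<in>UNIV. plane_pt (walk_plane x w m) z \<in> B}"
      by (auto simp: restr_plane_pt B_def)
  qed auto
  also have "\<dots> = (\<Sum>z\<in>UNIV. real (card {w\<in>W. plane_pt (walk_plane x w m) z \<in> B}))"
    by (subst ind, simp, subst sum.swap) (simp add: ind[OF finW])
  also have "\<dots> \<le> (\<Sum>(z :: 'a \<times> 'a)\<in>UNIV. (\<tau> + 2 / p) * real (card W))"
    by (intro sum_mono pt)
  also have "\<dots> = q\<^sup>2 * ((\<tau> + 2 / p) * real (card W))"
    by (simp add: q_def power2_eq_square)
  finally show ?thesis
    using q by (simp only: mult_le_cancel_left_pos zero_less_power)
qed

text \<open>Triangle inequality on the final plane: \<open>Q\<close> is far from \<open>g\<close> by
  the minimum distance and close to \<open>f\<close>.\<close>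

lemma walk_off_final:
  fixes f g :: "(nat \<Rightarrow> 'a::{field,finite}) \<Rightarrow> 'a" and d :: nat and \<rho> :: real
  defines "q \<equiv> real (card (UNIV :: 'a set))"
  defines "\<delta> \<equiv> 1 - real d / q"
  assumes "walk_off d \<rho> f g x w m" "\<And>j. j \<le> m \<Longrightarrow> \<not> walk_fails d \<rho> f x w j"
    and "restr g (walk_plane x w m) \<in> RM2 d"
  shows "(\<delta> - 2 * \<rho>) * q\<^sup>2 \<le> real (card {z. restr f (walk_plane x w m) z \<noteq> restr g (walk_plane x w m) z})"
proof -
  let ?u = "restr f (walk_plane x w m)" and ?g = "restr g (walk_plane x w m)"
  obtain Q where Q: "Q \<in> RM2 d" "real (card {z. ?u z \<noteq> Q z}) < 2 * \<rho> * q\<^sup>2" "Q \<noteq> ?g"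
    using assms(3,4) unfolding walk_off_def q_def by blast
  have "\<delta> * q\<^sup>2 \<le> real (card {z. Q z \<noteq> ?g z})"
    using RM2_card_neq[OF Q(1) assms(5) Q(3)] by (simp add: \<delta>_def q_def)
  also have "card {z. Q z \<noteq> ?g z} \<le> card ({z. ?u z \<noteq> Q z} \<union> {z. ?u z \<noteq> ?g z})"
    by (intro card_mono) auto
  also have "\<dots> \<le> card {z. ?u z \<noteq> Q z} + card {z. ?u z \<noteq> ?g z}" by (rule card_Un_le)
  finally have "\<delta> * q\<^sup>2 \<le> real (card {z. ?u z \<noteq> Q z}) + real (card {z. ?u z \<noteq> ?g z})" by simp
  then show ?thesis using Q(2) by (simp add: left_diff_distrib)
qed

text \<open>The extension degree is expressed by cardinality: \<open>q = card H ^ m\<close> says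
  that the field has dimension \<open>m\<close> over its prime subfield \<open>H\<close>.\<close>

theorem mainTheorem4:
  fixes d m :: nat and \<tau> \<rho> :: real
  defines "H \<equiv> (prime_subfield :: 'a::{field,finite} set)"
  defines "q \<equiv> card (UNIV :: 'a set)"
  defines "\<delta> \<equiv> 1 - real d / real q"
  assumes "d \<ge> 2" and "m \<ge> 2"
    and "q = card H ^ m"
    and "real q \<ge> 2 * real m * real d"
    and "\<tau> \<le> \<delta> / 2" and "\<rho> \<le> \<delta> / 8"
  shows
    "(\<forall>f \<in> (RM m d :: ((nat \<Rightarrow> 'a) \<Rightarrow> 'a) set). \<forall>x \<in> vecs m UNIV. \<forall>\<omega> \<in> walk_space m H.
        \<forall>i\<le>m. restr f (walk_plane x \<omega> i) \<in> RM2 d)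
     \<and>
     (\<forall>(f :: (nat \<Rightarrow> 'a) \<Rightarrow> 'a) Qs x. Qs \<in> RM m d \<longrightarrow> reldist m f Qs \<le> \<tau> \<longrightarrow>
        x \<in> vecs m UNIV \<longrightarrow> f x \<noteq> Qs x \<longrightarrow>
        measure_pmf.prob (pmf_of_set (walk_space m H))
          {\<omega>. wdist_set {(0, 0)} (restr f (walk_plane x \<omega> 0)) (RM2 d) \<ge> \<rho>
             \<or> (\<exists>i\<in>{1..m}. wdist_set {(t, 0) | t. True} (restr f (walk_plane x \<omega> i)) (RM2 d) \<ge> \<rho>)}
        \<ge> (1 - 4 / real q) ^ m - (\<tau> + 2 / real (card H)) / (\<delta> - 2 * \<rho>))"
proof -
  have complete: "restr f (walk_plane x w i) \<in> RM2 d"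
    if "f \<in> RM m d" "x \<in> vecs m UNIV" "w \<in> walk_space m H" "i \<le> m"
    for f :: "(nat \<Rightarrow> 'a) \<Rightarrow> 'a" and x w i
    using walk_plane_in_vecs[OF that(2-4)] restr_RM[OF that(1)]
    by (cases "walk_plane x w i") auto
  \<comment> \<open>From d, m \<ge> 2 follow md \<ge> 4, hence q \<ge> 8, and q \<ge> 4d, hence
    \<delta> \<ge> 3/4.\<close>
  have "2 * 2 \<le> m * d" using \<open>m \<ge> 2\<close> \<open>d \<ge> 2\<close> by (rule mult_le_mono)
  then have "4 \<le> real m * real d" by (metis (mono_tags) mult_2 numeral_Bit0 of_nat_le_iff of_nat_mult of_nat_numeral)
  then have q8: "real q \<ge> 8" using assms(7) by linarith
  have "2 * real d \<le> real m * real d" using \<open>m \<ge> 2\<close> by (intro mult_right_mono) auto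
  then have "4 * real d \<le> real q" using assms(7) by linarith
  then have \<delta>: "\<delta> \<ge> 3 / 4" using q8 by (simp add: \<delta>_def field_simps)
  have "(1 - 4 / real q) ^ m - (\<tau> + 2 / real (card H)) / (\<delta> - 2 * \<rho>)
      \<le> measure_pmf.prob (pmf_of_set (walk_space m H))
          {\<omega>. wdist_set {(0, 0)} (restr f (walk_plane x \<omega> 0)) (RM2 d) \<ge> \<rho>
             \<or> (\<exists>i\<in>{1..m}. wdist_set {(t, 0) | t. True} (restr f (walk_plane x \<omega> i)) (RM2 d) \<ge> \<rho>)}"
    if g: "g \<in> RM m d" and dist: "reldist m f g \<le> \<tau>" and x: "x \<in> vecs m UNIV" and ne: "f x \<noteq> g x"
    for f g :: "(nat \<Rightarrow> 'a) \<Rightarrow> 'a" and x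
  proof -
    let ?W = "walk_space m H"
    let ?E = "{\<omega>. wdist_set {(0, 0)} (restr f (walk_plane x \<omega> 0)) (RM2 d) \<ge> \<rho>
             \<or> (\<exists>i\<in>{1..m}. wdist_set {(t, 0) | t. True} (restr f (walk_plane x \<omega> i)) (RM2 d) \<ge> \<rho>)}"
    let ?Z = "{w\<in>?W. (\<delta> - 2 * \<rho>) * real q ^ 2 \<le>
        real (card {z. restr f (walk_plane x w m) z \<noteq> restr g (walk_plane x w m) z})}"
    have E: "w \<in> ?E \<longleftrightarrow> (\<exists>j\<le>m. walk_fails d \<rho> f x w j)" for w
    proof -
      have "(\<exists>j\<le>m. walk_fails d \<rho> f x w j) \<longleftrightarrow> walk_fails d \<rho> f x w 0 \<or> (\<exists>j\<in>{1..m}. walk_fails d \<rho> f x w j)"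
        by (metis One_nat_def Suc_leI atLeastAtMost_iff bot_nat_0.extremum gr0I)
      then show ?thesis by (simp add: walk_fails_def)
    qed
    have finW: "finite ?W" by (rule finite_walk_space)
    have "(\<lambda>_. 0) \<in> vecs m H" by (simp add: vecs_def H_def prime_subfield_closed)
    then have neW: "?W \<noteq> {}" by (auto simp: walk_space_def PiE_eq_empty_iff)
    \<comment> \<open>A walk that keeps the invariant to the end either fails some test or ends in a
      plane where \<open>f\<close> and \<open>g\<close> are far apart. The lower bound on the first
      set and the Markov bound on the last leave the claimed mass for the failing walks.\<close>
    have "{w\<in>?W. walk_off d \<rho> f g x w m} \<subseteq> (?W \<inter> ?E) \<union> ?Z"
    proof
      fix w assume w: "w \<in> {w\<in>?W. walk_off d \<rho> f g x w m}"
      show "w \<in> (?W \<inter> ?E) \<union> ?Z"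
      proof (cases "w \<in> ?E")
        case False
        then have nf: "\<not> walk_fails d \<rho> f x w j" if "j \<le> m" for j using E that by blast
        have "w \<in> ?Z"
          using walk_off_final[OF _ nf complete[OF g x]] w by (simp add: \<delta>_def q_def)
        then show ?thesis by blast
      qed (use w in blast)
    qed
    then have "card {w\<in>?W. walk_off d \<rho> f g x w m} \<le> card ((?W \<inter> ?E) \<union> ?Z)"
      using finW by (intro card_mono) auto
    also have "\<dots> \<le> card (?W \<inter> ?E) + card ?Z" by (rule card_Un_le)
    finally have le: "real (card {w\<in>?W. walk_off d \<rho> f g x w m}) \<le> real (card (?W \<inter> ?E)) + real (card ?Z)"
      by linarith
    have off: "(1 - 4 / real q) ^ m * real (card ?W) \<le> real (card {w\<in>?W. walk_off d \<rho> f g x w m})"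
      unfolding q_def by (rule card_walk_off) (use g x ne assms(9) \<delta> q8 in \<open>auto simp: \<delta>_def q_def\<close>)
    have pos: "\<delta> - 2 * \<rho> > 0" using \<delta> assms(9) by linarith
    have "(\<delta> - 2 * \<rho>) * real (card ?Z) \<le> (\<tau> + 2 / real (card H)) * real (card ?W)"
      using card_final_plane_far[OF x dist, of "\<delta> - 2 * \<rho>"] by (simp add: H_def q_def)
    then have "real (card ?Z) \<le> (\<tau> + 2 / real (card H)) / (\<delta> - 2 * \<rho>) * real (card ?W)"
      using pos by (simp add: field_simps)
    then have "((1 - 4 / real q) ^ m - (\<tau> + 2 / real (card H)) / (\<delta> - 2 * \<rho>)) * real (card ?W)
        \<le> real (card (?W \<inter> ?E))"
      using le off by (simp add: left_diff_distrib)
    moreover have "real (card ?W) > 0" using finW neW by (simp add: card_gt_0_iff)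
    ultimately have "(1 - 4 / real q) ^ m - (\<tau> + 2 / real (card H)) / (\<delta> - 2 * \<rho>)
        \<le> real (card (?W \<inter> ?E)) / real (card ?W)"
      by (simp add: pos_le_divide_eq)
    then show ?thesis by (simp only: measure_pmf_of_set[OF neW finW])
  qed
  with complete show ?thesis by blast
qed

end
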